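(* Let $V$ be a vector space with dimension $2n$ over a field $\mathbb{F}$, with $|\mathbb{F}|>2n-2$ and $n\geq 2$. Let $\mathcal{S}$ be an irreducible optimal symplectic affine subspace of $\mathcal{A}^2(V)$, and let $s_0\in\mathcal{S}$. Then $\mathcal{S}=s_0+W_{\mathbb{L}}$ for some quadratic extension $\mathbb{L}=\mathbb{F}[a]\subset\mathrm{End}(V)$ of $\mathbb{F}$ such that $(x,y)\mapsto s_0(x,a(y))$ is nonisotropic.
   Context: $\mathcal{A}^2(V)$ is the space of alternating bilinear forms on $V$. The characteristic of $\mathbb{F}$ is arbitrary. A bilinear form $b$ on $V$ is nonisotropic when $b(x,x)\neq 0$ for all $x\in V\setminus\{0\}$. A quadratic extension $\mathbb{L}\subset\mathrm{End}(V)$ of $\mathbb{F}$ is a subalgebra of $\mathrm{End}(V)$ containing $\mathbb{F}\,\mathrm{id}_V$ (identified with $\mathbb{F}$) that is a field of degree $2$ over $\mathbb{F}$; so $\mathbb{L}=\mathbb{F}[a]$ where $a\in\mathrm{End}(V)$ has an irreducible minimal polynomial of degree $2$. $W_{\mathbb{L}}$ is the set of all bilinear forms $s:V^2\to\mathbb{F}$ such that $s(x,\lambda(x))=0$ for all $x\in V$ and $\lambda\in\mathbb{L}$. An affine subspace of $\mathcal{A}^2(V)$ is symplectic when all its elements are non-degenerate; it is optimal when it has the greatest possible dimension among symplectic affine subspaces of $\mathcal{A}^2(V)$. A nonempty set $\mathcal{X}$ of symplectic forms on $V$ is irreducible when there is no nonzero linear subspace $W$ of $V$ such that the orthogonal $W^{\bot_s}=\{y\in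 V: s(x,y)=0\ \forall x\in W\}$ includes $W$ for every $s\in\mathcal{X}$ and does not depend on the choice of $s\in\mathcal{X}$. *)

theory Defs
  imports Complex_Main "HOL-Library.Function_Algebras"
begin

text \<open>
  The vector space \<open>V\<close> is the whole type \<open>'b\<close> with scalar multiplication
  \<open>scale :: 'a \<Rightarrow> 'b \<Rightarrow> 'b\<close> over the field \<open>'a\<close>. Forms are curried functions
  \<open>'b \<Rightarrow> 'b \<Rightarrow> 'a\<close>, added pointwise.
\<close>

definition form_scale :: "'a::field \<Rightarrow> ('b \<Rightarrow> 'b \<Rightarrow> 'a) \<Rightarrow> ('b \<Rightarrow> 'b \<Rightarrow> 'a)"
  where "form_scale c s = (\<lambda>x y. c * s x y)"

lemma vector_space_form_scale: "vector_space (form_scale :: 'a::field \<Rightarrow> ('b \<Rightarrow> 'b \<Rightarrow> 'a) \<Rightarrow> _)"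
  by unfold_locales (auto simp: form_scale_def fun_eq_iff algebra_simps)

definition end_scale ::
  "('a::field \<Rightarrow> 'b::ab_group_add \<Rightarrow> 'b) \<Rightarrow> 'a \<Rightarrow> ('b \<Rightarrow> 'b) \<Rightarrow> ('b \<Rightarrow> 'b)"
  where "end_scale scale c f = (\<lambda>x. scale c (f x))"

lemma vector_space_end_scale:
  assumes "vector_space scale"
  shows "vector_space (end_scale scale)"
proof -
  interpret vector_space scale by fact
  show ?thesis
    by unfold_locales (auto simp: end_scale_def fun_eq_iff algebra_simps)
qed

definition endomorphisms ::
  "('a::field \<Rightarrow> 'b::ab_group_add \<Rightarrow> 'b) \<Rightarrow> ('b \<Rightarrow> 'b) set"
  where "endomorphisms scale = {f. Vector_Spaces.linear scale scale f}"


subsection \<open>Bilinear forms\<close>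

definition bilinear_form ::
  "('a::field \<Rightarrow> 'b::ab_group_add \<Rightarrow> 'b) \<Rightarrow> ('b \<Rightarrow> 'b \<Rightarrow> 'a) \<Rightarrow> bool"
  where "bilinear_form scale s \<longleftrightarrow>
    (\<forall>x. Vector_Spaces.linear scale (*) (\<lambda>y. s x y)) \<and>
    (\<forall>y. Vector_Spaces.linear scale (*) (\<lambda>x. s x y))"

definition alternating_forms ::
  "('a::field \<Rightarrow> 'b::ab_group_add \<Rightarrow> 'b) \<Rightarrow> ('b \<Rightarrow> 'b \<Rightarrow> 'a) set"
  where "alternating_forms scale = {s. bilinear_form scale s \<and> (\<forall>x. s x x = 0)}"

definition nondegenerate :: "('b::zero \<Rightarrow> 'b \<Rightarrow> 'a::zero) \<Rightarrow> bool"
  where "nondegenerate s \<longleftrightarrow>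
    (\<forall>x. (\<forall>y. s x y = 0) \<longrightarrow> x = 0) \<and> (\<forall>y. (\<forall>x. s x y = 0) \<longrightarrow> y = 0)"

definition nonisotropic ::
  "('a::field \<Rightarrow> 'b::ab_group_add \<Rightarrow> 'b) \<Rightarrow> ('b \<Rightarrow> 'b \<Rightarrow> 'a) \<Rightarrow> bool"
  where "nonisotropic scale b \<longleftrightarrow> bilinear_form scale b \<and> (\<forall>x. x \<noteq> 0 \<longrightarrow> b x x \<noteq> 0)"

definition symplectic_form ::
  "('a::field \<Rightarrow> 'b::ab_group_add \<Rightarrow> 'b) \<Rightarrow> ('b \<Rightarrow> 'b \<Rightarrow> 'a) \<Rightarrow> bool"
  where "symplectic_form scale s \<longleftrightarrow> s \<in> alternating_forms scale \<and> nondegenerate s"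

definition orthogonal_of :: "('b \<Rightarrow> 'b \<Rightarrow> 'a::zero) \<Rightarrow> 'b set \<Rightarrow> 'b set"
  where "orthogonal_of s W = {y. \<forall>x\<in>W. s x y = 0}"


subsection \<open>Affine subspaces of the space of alternating forms\<close>

definition affine_subspace_alt ::
  "('a::field \<Rightarrow> 'b::ab_group_add \<Rightarrow> 'b) \<Rightarrow> ('b \<Rightarrow> 'b \<Rightarrow> 'a) set \<Rightarrow> bool"
  where "affine_subspace_alt scale S \<longleftrightarrow>
    (\<exists>s\<in>alternating_forms scale. \<exists>D\<subseteq>alternating_forms scale.
       module.subspace form_scale D \<and> S = (\<lambda>d. s + d) ` D)"

text \<open>For an affine subspace \<open>S\<close>, the set of differences is its translation vector space.\<close>

definition affine_dimension :: "('b \<Rightarrow> 'b \<Rightarrow> 'a::field) set \<Rightarrow> nat"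
  where "affine_dimension S = vector_space.dim form_scale {s - t | s t. s \<in> S \<and> t \<in> S}"

definition symplectic_affine_subspace ::
  "('a::field \<Rightarrow> 'b::ab_group_add \<Rightarrow> 'b) \<Rightarrow> ('b \<Rightarrow> 'b \<Rightarrow> 'a) set \<Rightarrow> bool"
  where "symplectic_affine_subspace scale S \<longleftrightarrow>
    affine_subspace_alt scale S \<and> (\<forall>s\<in>S. nondegenerate s)"

definition optimal_symplectic_affine_subspace ::
  "('a::field \<Rightarrow> 'b::ab_group_add \<Rightarrow> 'b) \<Rightarrow> ('b \<Rightarrow> 'b \<Rightarrow> 'a) set \<Rightarrow> bool"
  where "optimal_symplectic_affine_subspace scale S \<longleftrightarrow>
    symplectic_affine_subspace scale S \<and>
    (\<forall>T. symplectic_affine_subspace scale T \<longrightarrow> affine_dimension T \<le> affine_dimension S)"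

definition irreducible_forms ::
  "('a::field \<Rightarrow> 'b::ab_group_add \<Rightarrow> 'b) \<Rightarrow> ('b \<Rightarrow> 'b \<Rightarrow> 'a) set \<Rightarrow> bool"
  where "irreducible_forms scale X \<longleftrightarrow>
    X \<noteq> {} \<and> (\<forall>s\<in>X. symplectic_form scale s) \<and>
    \<not> (\<exists>W. module.subspace scale W \<and> W \<noteq> {0} \<and>
          (\<forall>s\<in>X. W \<subseteq> orthogonal_of s W) \<and>
          (\<forall>s\<in>X. \<forall>t\<in>X. orthogonal_of s W = orthogonal_of t W))"


subsection \<open>Quadratic extensions inside the endomorphism algebra\<close>

definition end_subalgebra ::
  "('a::field \<Rightarrow> 'b::ab_group_add \<Rightarrow> 'b) \<Rightarrow> ('b \<Rightarrow> 'b) set \<Rightarrow> bool"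
  where "end_subalgebra scale L \<longleftrightarrow>
    L \<subseteq> endomorphisms scale \<and> module.subspace (end_scale scale) L \<and>
    id \<in> L \<and> (\<forall>f\<in>L. \<forall>g\<in>L. f \<circ> g \<in> L)"

text \<open>
  The product is composition with unit \<open>id\<close>: the pointwise \<open>*\<close> and \<open>1\<close> that Function Algebras
  puts on functions are not the operations of the endomorphism algebra.
\<close>

definition quadratic_extension ::
  "('a::field \<Rightarrow> 'b::ab_group_add \<Rightarrow> 'b) \<Rightarrow> ('b \<Rightarrow> 'b) set \<Rightarrow> bool"
  where "quadratic_extension scale L \<longleftrightarrow>
    end_subalgebra scale L \<and>
    id \<noteq> (0 :: 'b \<Rightarrow> 'b) \<and>
    (\<forall>f\<in>L. \<forall>g\<in>L. f \<circ> g = g \<circ> f) \<and>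
    (\<forall>f\<in>L. f \<noteq> 0 \<longrightarrow> (\<exists>g\<in>L. f \<circ> g = id \<and> g \<circ> f = id)) \<and>
    vector_space.dim (end_scale scale) L = 2"

text \<open>\<open>\<F>[a]\<close>: the linear combinations of the iterates of \<open>a\<close>.\<close>

definition generated_algebra ::
  "('a::field \<Rightarrow> 'b::ab_group_add \<Rightarrow> 'b) \<Rightarrow> ('b \<Rightarrow> 'b) \<Rightarrow> ('b \<Rightarrow> 'b) set"
  where "generated_algebra scale a = module.span (end_scale scale) (range (\<lambda>k::nat. a ^^ k))"

definition W_space ::
  "('a::field \<Rightarrow> 'b::ab_group_add \<Rightarrow> 'b) \<Rightarrow> ('b \<Rightarrow> 'b) set \<Rightarrow> ('b \<Rightarrow> 'b \<Rightarrow> 'a) set"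
  where "W_space scale L = {s. bilinear_form scale s \<and> (\<forall>x. \<forall>l\<in>L. s x (l x) = 0)}"

end

theory Submission
  imports Defs
begin

text \<open>
  Write \<open>S = s0 + D\<close> and \<open>x ~ y\<close> for \<open>s x y = 0\<close> for all \<open>s\<close> in \<open>S\<close>. If \<open>D\<close> contains the rank two form
  \<open>s x \<and> s y\<close>, then \<open>x ~ y\<close>: the solutions \<open>w\<close> of \<open>(t s + d) w = s x\<close> are orthogonal to \<open>y\<close>
  under \<open>s\<close> and, for enough scalars \<open>t\<close>, they span \<open>x\<close>, which forces \<open>d x y = 0\<close>. Splitting \<open>D\<close> along a vector and an inductive
  dimension count then give \<open>dim D \<le> n (n - 1)\<close>, and in the optimal case the converse: \<open>x ~ y\<close> implies
  that \<open>s x \<and> s y\<close> lies in \<open>D\<close>. So \<open>~\<close> is preserved by all \<open>t\<inverse> s\<close> with \<open>s\<close>, \<open>t\<close> in \<open>S\<close>, and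
  if some \<open>y\<close> were related to more than its multiples, a \<open>y\<close> with the largest related space would yield a
  subspace contradicting irreducibility.

  Hence the common orthogonal of each nonzero \<open>x\<close> under \<open>D\<close> is a plane \<open>P x\<close>, and these planes partition
  \<open>V\<close>. An element of \<open>D\<close> that annihilates \<open>x\<close> annihilates \<open>P x\<close>, so for \<open>x'\<close> in \<open>P x\<close> one can solve
  \<open>d x' z = d x w\<close> for \<open>w\<close> modulo \<open>P x\<close>, uniformly in \<open>d\<close>. Gluing the solutions for two base vectors
  \<open>x\<close>, \<open>y\<close> in different planes gives a linear \<open>a\<close> with \<open>a z \<in> P z\<close> for all \<open>z\<close>, which is quadratic over
  the base field without eigenvectors. Then \<open>D\<close> lies in the space \<open>W\<close> of \<open>\<F>[a]\<close>, and the dimension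
  bound makes them equal.
\<close>

section \<open>Linear functionals and relations\<close>

lemma functionalI:
  assumes "vector_space scale" "\<And>x y. f (x + y) = f x + f y" "\<And>c x. f (scale c x) = c * f x"
  shows "Vector_Spaces.linear scale (*) f"
proof -
  interpret vector_space scale by fact
  interpret F: vector_space "(*) :: 'a \<Rightarrow> 'a \<Rightarrow> 'a"
    by unfold_locales (simp_all add: algebra_simps)
  show ?thesis
    by unfold_locales (simp_all add: assms)
qed

lemma functionalD:
  assumes "Vector_Spaces.linear scale (*) f"
  shows "f (x + y) = f x + f y" "f (scale c x) = c * f x" "f 0 = 0" "f (x - y) = f x - f y"
    "f (- x) = - f x" "f (sum g I) = (\<Sum>i\<in>I. f (g i))"
proof -
  interpret module_hom scale "(*)" f
    using assms by (simp add: linear_iff_module_hom)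
  show "f (x + y) = f x + f y" "f (scale c x) = c * f x" "f 0 = 0" "f (x - y) = f x - f y"
    "f (- x) = - f x" "f (sum g I) = (\<Sum>i\<in>I. f (g i))"
    by (simp_all add: add scale diff neg sum)
qed

lemma functional_sum:
  assumes "vector_space scale" "\<And>i. i \<in> I \<Longrightarrow> Vector_Spaces.linear scale (*) (f i)"
  shows "Vector_Spaces.linear scale (*) (\<lambda>x. \<Sum>i\<in>I. c i * f i x)"
  using assms(1)
proof (rule functionalI)
  show "(\<Sum>i\<in>I. c i * f i (x + y)) = (\<Sum>i\<in>I. c i * f i x) + (\<Sum>i\<in>I. c i * f i y)" for x y
    by (simp add: functionalD[OF assms(2)] algebra_simps sum.distrib)
  show "(\<Sum>i\<in>I. c i * f i (scale k x)) = k * (\<Sum>i\<in>I. c i * f i x)" for k x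
    by (simp add: functionalD[OF assms(2)] sum_distrib_left algebra_simps)
qed

context vector_space begin

text \<open>Induction on \<open>I\<close>: on the kernel of \<open>f j\<close> in \<open>A\<close>
  the induction hypothesis expresses \<open>g\<close>, and what remains vanishes on that kernel, so
  it is a multiple of \<open>f j\<close> on \<open>A\<close>. Stated for arbitrary vector spaces
  because it is applied to spaces of forms as well.\<close>

lemma functional_in_span_of_finite:
  assumes "finite I" "\<And>i. i \<in> I \<Longrightarrow> Vector_Spaces.linear scale (*) (f i)"
    "Vector_Spaces.linear scale (*) g" "subspace A"
    "\<And>a. a \<in> A \<Longrightarrow> (\<forall>i\<in>I. f i a = 0) \<Longrightarrow> g a = 0"
  shows "\<exists>c. \<forall>a\<in>A. g a = (\<Sum>i\<in>I. c i * f i a)"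
  using assms
proof (induction I arbitrary: A rule: finite_induct)
  case empty
  then show ?case by simp
next
  case (insert j I)
  note fl = insert.prems(1) and gl = insert.prems(2)
  define A' where "A' = {a\<in>A. f j a = 0}"
  have "subspace A'"
    using insert.prems(3) unfolding A'_def subspace_def
    by (simp add: functionalD[OF fl])
  moreover have "g a = 0" if "a \<in> A'" "\<forall>i\<in>I. f i a = 0" for a
    using that insert.prems(4) by (simp add: A'_def)
  ultimately obtain c where c: "\<forall>a\<in>A'. g a = (\<Sum>i\<in>I. c i * f i a)"
    using insert.IH[of A'] fl gl by blast
  define h where "h = (\<lambda>a. g a - (\<Sum>i\<in>I. c i * f i a))"
  have hl: "h (x - scale k y) = h x - k * h y" for x y k
  proof -
    note sl = functional_sum[OF vector_space_axioms fl, of I "\<lambda>i. i" c]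
    have "(\<Sum>i\<in>I. c i * f i (x - scale k y)) = (\<Sum>i\<in>I. c i * f i x) - k * (\<Sum>i\<in>I. c i * f i y)"
      using functionalD(4)[OF sl, of x "scale k y"] functionalD(2)[OF sl, of k y] by simp
    then show ?thesis
      unfolding h_def using functionalD(4)[OF gl, of x "scale k y"] functionalD(2)[OF gl]
      by (simp add: algebra_simps)
  qed
  have h0: "h a = 0" if "a \<in> A" "f j a = 0" for a
    using c that by (simp add: A'_def h_def)
  have "\<exists>k. \<forall>a\<in>A. h a = k * f j a"
  proof (cases "\<forall>a\<in>A. f j a = 0")
    case True
    then show ?thesis using h0 by auto
  next
    case False
    then obtain b where b: "b \<in> A" "f j b \<noteq> 0" by blast
    have "h a = h b / f j b * f j a" if "a \<in> A" for a
    proof -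
      have "h (a - scale (f j a / f j b) b) = 0"
        using b that insert.prems(3)
        by (intro h0) (auto simp: functionalD[OF fl] intro: subspace_diff subspace_scale)
      then show ?thesis using b by (simp add: hl)
    qed
    then show ?thesis by blast
  qed
  then obtain k where k: "\<forall>a\<in>A. h a = k * f j a" by blast
  have "g a = (\<Sum>i\<in>insert j I. (c(j := k)) i * f i a)" if "a \<in> A" for a
  proof -
    have "(\<Sum>i\<in>I. (c(j := k)) i * f i a) = (\<Sum>i\<in>I. c i * f i a)"
      using insert.hyps by (intro sum.cong) auto
    then show ?thesis
      using insert.hyps k that by (simp add: h_def algebra_simps)
  qed
  then show ?case by blast
qed

lemma span_Un_image_finite:
  assumes "finite I" "subspace U" "v \<in> span (U \<union> w ` I)"
  shows "\<exists>c. v - (\<Sum>i\<in>I. scale (c i) (w i)) \<in> U"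
  using assms(1,3)
proof (induction I arbitrary: v rule: finite_induct)
  case empty
  then show ?case using assms(2) by (simp add: span_eq_iff[THEN iffD2])
next
  case (insert j I)
  then obtain k where "v - scale k (w j) \<in> span (U \<union> w ` I)"
    by (auto simp: span_breakdown_eq)
  then obtain c where c: "v - scale k (w j) - (\<Sum>i\<in>I. scale (c i) (w i)) \<in> U"
    using insert.IH by blast
  have "(\<Sum>i\<in>I. scale ((c(j := k)) i) (w i)) = (\<Sum>i\<in>I. scale (c i) (w i))"
    using insert.hyps by (intro sum.cong) auto
  then have "v - (\<Sum>i\<in>insert j I. scale ((c(j := k)) i) (w i)) \<in> U"
    using c insert.hyps by (simp add: algebra_simps)
  then show ?case by blast
qed

end

context finite_dimensional_vector_space begin

lemma dim_psubset_subspace: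
  assumes "subspace S" "subspace T" "S \<subset> T"
  shows "dim S < dim T"
proof (rule dim_psubset)
  have "span S = S" "span T = T" using assms by simp_all
  then show "span S \<subset> span T" using assms(3) by (simp only:)
qed

text \<open>\<open>key\<close> is the contrapositive: if only zero coefficients give a combination
  in \<open>U\<close>, every index raises the dimension by one above \<open>dim U\<close>. Indexed
  families are used instead of sets because \<open>w\<close> may repeat vectors.\<close>

lemma family_relation_mod:
  assumes "finite I" "subspace U" "subspace Q" "U \<subseteq> Q" "w ` I \<subseteq> Q" "dim Q < dim U + card I"
  obtains c i where "i \<in> I" "c i \<noteq> 0" "(\<Sum>i\<in>I. scale (c i) (w i)) \<in> U"
proof -
  have key: "dim U + card I \<le> dim (U \<union> w ` I)"
    if "\<And>c. (\<Sum>i\<in>I. scale (c i) (w i)) \<in> U \<Longrightarrow> \<forall>i\<in>I. c i = 0"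
    using assms(1) that
  proof (induction I rule: finite_induct)
    case empty
    then show ?case by simp
  next
    case (insert j I)
    have "w j \<notin> span (U \<union> w ` I)"
    proof
      assume "w j \<in> span (U \<union> w ` I)"
      then obtain c where c: "w j - (\<Sum>i\<in>I. scale (c i) (w i)) \<in> U"
        using span_Un_image_finite insert.hyps assms(2) by blast
      define c' where "c' = (\<lambda>i. if i = j then 1 else - c i)"
      have "(\<Sum>i\<in>I. scale (c' i) (w i)) = (\<Sum>i\<in>I. - scale (c i) (w i))"
        using insert.hyps by (intro sum.cong) (auto simp: c'_def)
      then have "(\<Sum>i\<in>insert j I. scale (c' i) (w i)) \<in> U"
        using c insert.hyps by (simp add: c'_def sum_negf)
      then have "c' j = 0" using insert.prems by blast
      then show False by (simp add: c'_def)
    qed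
    moreover have "\<forall>i\<in>I. c i = 0" if "(\<Sum>i\<in>I. scale (c i) (w i)) \<in> U" for c
    proof -
      have "(\<Sum>i\<in>I. scale ((c(j := 0)) i) (w i)) = (\<Sum>i\<in>I. scale (c i) (w i))"
        using insert.hyps by (intro sum.cong) auto
      then have "\<forall>i\<in>insert j I. (c(j := 0)) i = 0"
        using insert.hyps that insert.prems[of "c(j := 0)"] by simp
      then show ?thesis using insert.hyps by (metis fun_upd_other insertI2)
    qed
    ultimately show ?case
      using insert.IH insert.hyps by (simp add: dim_insert)
  qed
  have "dim (U \<union> w ` I) \<le> dim Q"
    using assms by (intro dim_subset) auto
  then show ?thesis using key assms(6) that by fastforce
qed

text \<open>A finite subset of \<open>Fs\<close> whose common kernel in \<open>A\<close> has least
  dimension already has the common kernel of all of \<open>Fs\<close>. This reduces the claim to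
  finitely many functionals.\<close>

lemma functional_in_family:
  assumes "subspace A"
    and lin: "\<And>f. f \<in> Fs \<Longrightarrow> Vector_Spaces.linear scale (*) f"
    and add: "\<And>f g. f \<in> Fs \<Longrightarrow> g \<in> Fs \<Longrightarrow> (\<lambda>x. f x + g x) \<in> Fs"
    and mult: "\<And>f c. f \<in> Fs \<Longrightarrow> (\<lambda>x. c * f x) \<in> Fs"
    and "Fs \<noteq> {}"
    and g: "Vector_Spaces.linear scale (*) g"
    and "\<And>a. a \<in> A \<Longrightarrow> (\<forall>f\<in>Fs. f a = 0) \<Longrightarrow> g a = 0"
  obtains f where "f \<in> Fs" "\<And>a. a \<in> A \<Longrightarrow> g a = f a"
proof -
  define K where "K = (\<lambda>I :: ('b \<Rightarrow> 'a) set. {a\<in>A. \<forall>f\<in>I. f a = 0})"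
  have K: "subspace (K I)" if "I \<subseteq> Fs" for I
    using assms(1) that unfolding K_def subspace_def by (auto simp: functionalD[OF lin] subset_iff)
  define P where "P = (\<lambda>I. finite I \<and> I \<subseteq> Fs)"
  have "P {}" by (simp add: P_def)
  then obtain I where I: "P I" "\<And>J. P J \<Longrightarrow> dim (K I) \<le> dim (K J)"
    using ex_has_least_nat[of P "{}" "\<lambda>I. dim (K I)"] by blast
  have common: "f a = 0" if "a \<in> K I" "f \<in> Fs" for a f
  proof (rule ccontr)
    assume "f a \<noteq> 0"
    then have "K (insert f I) \<subset> K I"
      using that by (auto simp: K_def)
    moreover have "P (insert f I)" using I that by (simp add: P_def)
    ultimately have "dim (K (insert f I)) < dim (K I)"
      using I(1) \<open>P (insert f I)\<close> K unfolding P_def by (metis dim_psubset_subspace)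
    with I(2)[OF \<open>P (insert f I)\<close>] show False by simp
  qed
  have "\<exists>c. \<forall>a\<in>A. g a = (\<Sum>f\<in>I. c f * f a)"
  proof (rule functional_in_span_of_finite)
    show "finite I" "subspace A" "Vector_Spaces.linear scale (*) g"
      using I assms by (auto simp: P_def)
    show "Vector_Spaces.linear scale (*) f" if "f \<in> I" for f
      using that I lin by (auto simp: P_def)
    show "g a = 0" if "a \<in> A" "\<forall>f\<in>I. f a = 0" for a
    proof -
      have "a \<in> K I" using that by (simp add: K_def)
      then have "\<forall>f\<in>Fs. f a = 0" using common by blast
      then show ?thesis using assms(7) that(1) by blast
    qed
  qed
  then obtain c where c: "\<forall>a\<in>A. g a = (\<Sum>f\<in>I. c f * f a)" by blast
  obtain f0 where "f0 \<in> Fs" using assms(5) by blast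
  then have zero: "(\<lambda>x. 0) \<in> Fs" using mult[of f0 0] by simp
  have "finite I" "I \<subseteq> Fs" using I by (auto simp: P_def)
  then have "(\<lambda>a. \<Sum>f\<in>I. c f * f a) \<in> Fs"
  proof (induction I rule: finite_induct)
    case empty
    then show ?case using zero by simp
  next
    case (insert f I)
    then show ?case using add[OF mult[of f "c f"], of "\<lambda>a. \<Sum>f\<in>I. c f * f a"] by simp
  qed
  then show ?thesis using that c by blast
qed

text \<open>Each chosen \<open>a\<close> is nonzero on some element of the current \<open>Y\<close>
  and so cuts \<open>Y\<close> down to a proper subspace; hence at most \<open>dim Y\<close> choices
  occur.\<close>

lemma separating_finite_subset:
  assumes "subspace Y" "subspace A"
    and "\<And>a. a \<in> A \<Longrightarrow> Vector_Spaces.linear scale (*) (\<lambda>y. \<beta> y a)"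
    and "\<And>y. y \<in> Y \<Longrightarrow> (\<forall>a\<in>A. \<beta> y a = 0) \<Longrightarrow> y = 0"
  shows "\<exists>C. finite C \<and> C \<subseteq> A \<and> card C \<le> dim Y \<and> (\<forall>y\<in>Y. (\<forall>a\<in>C. \<beta> y a = 0) \<longrightarrow> y = 0)"
  using assms(1,4)
proof (induction "dim Y" arbitrary: Y rule: less_induct)
  case less
  show ?case
  proof (cases "Y \<subseteq> {0}")
    case True
    then show ?thesis by (intro exI[of _ "{}"]) auto
  next
    case False
    then obtain y where y: "y \<in> Y" "y \<noteq> 0" by blast
    then obtain a where a: "a \<in> A" "\<beta> y a \<noteq> 0" using less.prems by blast
    define Y' where "Y' = {y\<in>Y. \<beta> y a = 0}"
    have sub: "subspace Y'"
      using less.prems(1) unfolding Y'_def subspace_def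
      by (simp add: functionalD[OF assms(3)[OF a(1)]])
    have "Y' \<subset> Y" using y a by (auto simp: Y'_def)
    then have lt: "dim Y' < dim Y"
      using dim_psubset_subspace sub less.prems(1) by blast
    then obtain C where C: "finite C" "C \<subseteq> A" "card C \<le> dim Y'"
        "\<forall>y\<in>Y'. (\<forall>a\<in>C. \<beta> y a = 0) \<longrightarrow> y = 0"
      using less.hyps[of Y'] sub less.prems(2) by (auto simp: Y'_def)
    then show ?thesis
      using a lt by (intro exI[of _ "insert a C"]) (auto simp: Y'_def card_insert_if)
  qed
qed

lemma complement_basis:
  assumes "subspace P" "P \<subseteq> A" "subspace A"
  obtains C where "finite C" "C \<subseteq> A" "card C = dim A - dim P" "A \<subseteq> span (P \<union> C)"
proof -
  obtain B where B: "B \<subseteq> P" "independent B" "P \<subseteq> span B" "card B = dim P"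
    using basis_exists[of P] by blast
  obtain B' where B': "B \<subseteq> B'" "B' \<subseteq> A" "independent B'" "A \<subseteq> span B'"
    using maximal_independent_subset_extend[of B A] B assms by blast
  have fin: "finite B'" using B' finiteI_independent by blast
  then have "card (B' - B) = dim A - dim P"
    using B B' basis_card_eq_dim[of B' A] by (simp add: card_Diff_subset finite_subset)
  moreover have "A \<subseteq> span (P \<union> (B' - B))"
    using B'(4) span_mono[of B' "P \<union> (B' - B)"] B(1) by blast
  ultimately show ?thesis using that[of "B' - B"] fin B'(2) by blast
qed

end

text \<open>Multiplying a relation by \<open>t - a\<close> kills its coefficient at \<open>a\<close>, so the support can be
  shrunk to a single index.\<close>

lemma singleton_relation:
  fixes R :: "('f::field \<Rightarrow> 'f) set"
  assumes "finite T" "\<And>c a. c \<in> R \<Longrightarrow> (\<lambda>t. (t - a) * c t) \<in> R" "c \<in> R" "t \<in> T" "c t \<noteq> 0"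
  obtains c t where "c \<in> R" "t \<in> T" "c t \<noteq> 0" "\<And>u. u \<in> T \<Longrightarrow> u \<noteq> t \<Longrightarrow> c u = 0"
proof -
  define supp where "supp = (\<lambda>c::'f \<Rightarrow> 'f. {t\<in>T. c t \<noteq> 0})"
  have fin: "finite (supp c)" for c using assms(1) by (simp add: supp_def)
  define P where "P = (\<lambda>c. c \<in> R \<and> supp c \<noteq> {})"
  have "P c" using assms by (auto simp: P_def supp_def)
  then obtain c where c: "P c" "\<And>c'. P c' \<Longrightarrow> card (supp c) \<le> card (supp c')"
    using ex_has_least_nat[of P c "\<lambda>c. card (supp c)"] by blast
  then obtain t where t: "t \<in> supp c" by (auto simp: P_def)
  have "c u = 0" if "u \<in> T" "u \<noteq> t" for u
  proof (rule ccontr)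
    assume "c u \<noteq> 0"
    define c' where "c' = (\<lambda>s. (s - t) * c s)"
    have "supp c' \<subset> supp c" using t by (auto simp: supp_def c'_def)
    then have "card (supp c') < card (supp c)" using fin psubset_card_mono by blast
    moreover have "u \<in> supp c'" using that \<open>c u \<noteq> 0\<close> by (simp add: supp_def c'_def)
    then have "P c'" using c(1) assms(2)[of c t] by (auto simp: P_def c'_def)
    ultimately show False using c(2) by fastforce
  qed
  then show ?thesis using that[of c t] c t by (auto simp: P_def supp_def)
qed

section \<open>Affine families of forms that are nondegenerate on a subspace\<close>

interpretation forms: vector_space "form_scale :: 'f::field \<Rightarrow> ('v \<Rightarrow> 'v \<Rightarrow> 'f) \<Rightarrow> _"
  by (rule vector_space_form_scale)

lemma form_scale_apply [simp]: "form_scale c s x y = c * s x y"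
  by (simp add: form_scale_def)

lemma alternating_simps:
  assumes "s \<in> alternating_forms scale"
  shows "s (x + y) z = s x z + s y z" "s (scale c x) z = c * s x z" "s 0 z = 0"
    "s (x - y) z = s x z - s y z" "s (- x) z = - s x z" "s (sum g I) z = (\<Sum>i\<in>I. s (g i) z)"
    "s z (x + y) = s z x + s z y" "s z (scale c x) = c * s z x" "s z 0 = 0"
    "s z (x - y) = s z x - s z y" "s z (- x) = - s z x" "s z (sum g I) = (\<Sum>i\<in>I. s z (g i))"
    "s x x = 0"
proof -
  have l: "Vector_Spaces.linear scale (*) (\<lambda>x. s x z)" "Vector_Spaces.linear scale (*) (s z)"
    and "s x x = 0"
    using assms by (auto simp: alternating_forms_def bilinear_form_def)
  show "s (x + y) z = s x z + s y z" "s (scale c x) z = c * s x z" "s 0 z = 0"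
    "s (x - y) z = s x z - s y z" "s (- x) z = - s x z" "s (sum g I) z = (\<Sum>i\<in>I. s (g i) z)"
    using functionalD[OF l(1)] by auto
  show "s z (x + y) = s z x + s z y" "s z (scale c x) = c * s z x" "s z 0 = 0"
    "s z (x - y) = s z x - s z y" "s z (- x) = - s z x" "s z (sum g I) = (\<Sum>i\<in>I. s z (g i))"
    using functionalD[OF l(2)] by auto
  show "s x x = 0" by fact
qed

lemma alternating_skew:
  assumes "s \<in> alternating_forms scale"
  shows "s x y = - s y x"
proof -
  have "0 = s (x + y) (x + y)" using alternating_simps(13)[OF assms] by simp
  also have "\<dots> = s x y + s y x"
    by (simp only: alternating_simps(1,7)[OF assms]) (simp add: alternating_simps(13)[OF assms])
  finally have "s x y + s y x = 0" by simp
  then show ?thesis by (simp add: eq_neg_iff_add_eq_0)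
qed

lemma alternating_linear:
  assumes "s \<in> alternating_forms scale"
  shows "Vector_Spaces.linear scale (*) (s x)" "Vector_Spaces.linear scale (*) (\<lambda>x. s x y)"
  using assms by (auto simp: alternating_forms_def bilinear_form_def)

text \<open>The decomposable two-form built from two functionals; it has rank two when they are
  linearly independent.\<close>

definition wedge :: "('v \<Rightarrow> 'f::field) \<Rightarrow> ('v \<Rightarrow> 'f) \<Rightarrow> 'v \<Rightarrow> 'v \<Rightarrow> 'f"
  where "wedge f g = (\<lambda>u v. f u * g v - f v * g u)"

text \<open>\<open>determined D A k\<close> says that restricting the space \<open>D\<close> of forms to \<open>A\<close> leaves a space of
  dimension at most \<open>k\<close>.\<close>

definition determined :: "('v \<Rightarrow> 'v \<Rightarrow> 'f::zero) set \<Rightarrow> 'v set \<Rightarrow> nat \<Rightarrow> bool"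
  where "determined D A k \<longleftrightarrow> (\<exists>G. finite G \<and> card G \<le> k \<and>
    (\<forall>d\<in>D. (\<forall>(a, b)\<in>G. d a b = 0) \<longrightarrow> (\<forall>a\<in>A. \<forall>b\<in>A. d a b = 0)))"

lemma determined_mono: "determined D A k \<Longrightarrow> k \<le> l \<Longrightarrow> determined D A l"
  unfolding determined_def by (meson le_trans)

text \<open>Nondegeneracy is demanded on \<open>A\<close> only, while the forms stay defined on the
  whole space. Thus an induction can shrink \<open>A\<close> and \<open>D\<close> without changing
  types or restricting functions.\<close>

locale nondeg_family = finite_dimensional_vector_space scale Basis
  for scale :: "'f::field \<Rightarrow> 'v::ab_group_add \<Rightarrow> 'v" and Basis +
  fixes A :: "'v set" and s0 :: "'v \<Rightarrow> 'v \<Rightarrow> 'f" and D :: "('v \<Rightarrow> 'v \<Rightarrow> 'f) set"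
  assumes subspace_A: "subspace A"
    and s0_alternating: "s0 \<in> alternating_forms scale"
    and D_alternating: "D \<subseteq> alternating_forms scale"
    and subspace_D: "forms.subspace D"
    and nondeg: "\<And>d x. d \<in> D \<Longrightarrow> x \<in> A \<Longrightarrow> (\<And>y. y \<in> A \<Longrightarrow> s0 x y + d x y = 0) \<Longrightarrow> x = 0"
begin

lemmas A_closed = subspace_0[OF subspace_A] subspace_add[OF subspace_A]
  subspace_scale[OF subspace_A] subspace_diff[OF subspace_A] subspace_sum[OF subspace_A]

lemmas D_closed = forms.subspace_0[OF subspace_D] forms.subspace_add[OF subspace_D]
  forms.subspace_scale[OF subspace_D] forms.subspace_diff[OF subspace_D]

lemmas s0_simps = alternating_simps[OF s0_alternating]

lemma D_simps:
  assumes "d \<in> D"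
  shows "d (x + y) z = d x z + d y z" "d (scale c x) z = c * d x z" "d 0 z = 0"
    "d (x - y) z = d x z - d y z" "d (- x) z = - d x z" "d (sum g I) z = (\<Sum>i\<in>I. d (g i) z)"
    "d z (x + y) = d z x + d z y" "d z (scale c x) = c * d z x" "d z 0 = 0"
    "d z (x - y) = d z x - d z y" "d z (- x) = - d z x" "d z (sum g I) = (\<Sum>i\<in>I. d z (g i))"
    "d x x = 0"
  using alternating_simps[OF subsetD[OF D_alternating assms]] by auto

lemma D_skew: "d \<in> D \<Longrightarrow> d x y = - d y x"
  using D_alternating alternating_skew by blast

lemmas s0_skew = alternating_skew[OF s0_alternating]

lemma nondeg0: "x \<in> A \<Longrightarrow> (\<And>y. y \<in> A \<Longrightarrow> s0 x y = 0) \<Longrightarrow> x = 0"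
  using nondeg[OF D_closed(1)] by simp

text \<open>A nondegenerate form identifies \<open>A\<close> with its dual: the functionals induced
  by \<open>s0 + d\<close> are closed under linear combinations, and their only common zero in
  \<open>A\<close> is 0.\<close>

lemma represent:
  assumes "d \<in> D" "Vector_Spaces.linear scale (*) g"
  obtains z where "z \<in> A" "\<And>a. a \<in> A \<Longrightarrow> s0 z a + d z a = g a"
proof -
  let ?Fs = "{(\<lambda>y. s0 z y + d z y) | z. z \<in> A}"
  have "\<exists>f\<in>?Fs. \<forall>a\<in>A. g a = f a"
  proof (rule functional_in_family[OF subspace_A _ _ _ _ assms(2), of ?Fs])
    fix f assume "f \<in> ?Fs"
    then show "Vector_Spaces.linear scale (*) f"
      by (auto intro!: functionalI vector_space_axioms simp: s0_simps D_simps[OF assms(1)] algebra_simps)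
  next
    fix f h assume "f \<in> ?Fs" "h \<in> ?Fs"
    then obtain z z' where z: "z \<in> A" "f = (\<lambda>y. s0 z y + d z y)"
      "z' \<in> A" "h = (\<lambda>y. s0 z' y + d z' y)" by blast
    show "(\<lambda>x. f x + h x) \<in> ?Fs"
      using z by (intro CollectI exI[of _ "z + z'"])
        (auto simp: s0_simps D_simps[OF assms(1)] A_closed algebra_simps)
  next
    fix f c assume "f \<in> ?Fs"
    then obtain z where z: "z \<in> A" "f = (\<lambda>y. s0 z y + d z y)" by blast
    show "(\<lambda>x. c * f x) \<in> ?Fs"
      using z by (intro CollectI exI[of _ "scale c z"])
        (auto simp: s0_simps D_simps[OF assms(1)] A_closed algebra_simps)
  next
    show "?Fs \<noteq> {}" using A_closed(1) by blast
  next
    fix a assume a: "a \<in> A" "\<forall>f\<in>?Fs. f a = 0"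
    then have z: "s0 z a + d z a = 0" if "z \<in> A" for z
      using bspec[OF a(2), of "\<lambda>y. s0 z y + d z y"] that by auto
    have "a = 0"
    proof (rule nondeg[OF assms(1) a(1)])
      fix y assume "y \<in> A"
      then show "s0 a y + d a y = 0"
        using z[of y] s0_skew[of a y] D_skew[OF assms(1), of a y] by (metis add.inverse_distrib_swap add.commute neg_0_equal_iff_equal)
    qed
    then show "g a = 0" using functionalD(3)[OF assms(2)] by simp
  next
    fix f assume "f \<in> ?Fs" "\<And>a. a \<in> A \<Longrightarrow> g a = f a"
    then show "\<exists>f\<in>?Fs. \<forall>a\<in>A. g a = f a" by (intro bexI ballI)
  qed
  then show ?thesis using that by auto
qed

definition null :: "'v \<Rightarrow> 'v set"
  where "null x = {a\<in>A. \<forall>d\<in>D. d x a = 0}"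

definition stab :: "'v \<Rightarrow> ('v \<Rightarrow> 'v \<Rightarrow> 'f) set"
  where "stab x = {d\<in>D. \<forall>a\<in>A. d x a = 0}"

text \<open>The forms of rank two in \<open>D\<close>, as decomposable bivectors \<open>x \<and> y\<close> via \<open>s0\<close>.\<close>

definition partners :: "'v \<Rightarrow> 'v set"
  where "partners x = {y\<in>A. \<exists>e\<in>D. \<forall>u\<in>A. \<forall>v\<in>A. e u v = wedge (s0 x) (s0 y) u v}"

lemma subspace_null: "subspace (null x)"
  unfolding null_def by (rule subspaceI) (auto simp: A_closed D_simps)

lemma subspace_partners: "subspace (partners x)"
proof (rule subspaceI)
  show "0 \<in> partners x"
    using D_closed(1) by (auto simp: partners_def wedge_def A_closed s0_simps intro!: bexI[of _ 0])
next
  fix y z assume "y \<in> partners x" "z \<in> partners x"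
  then obtain d e where "y \<in> A" "z \<in> A" "d \<in> D" "e \<in> D"
    "\<forall>u\<in>A. \<forall>v\<in>A. d u v = wedge (s0 x) (s0 y) u v" "\<forall>u\<in>A. \<forall>v\<in>A. e u v = wedge (s0 x) (s0 z) u v"
    unfolding partners_def by blast
  moreover have "wedge (s0 x) (s0 (y + z)) u v = wedge (s0 x) (s0 y) u v + wedge (s0 x) (s0 z) u v"
    for u v by (simp add: wedge_def s0_simps algebra_simps)
  ultimately show "y + z \<in> partners x"
    unfolding partners_def by (auto intro!: bexI[of _ "d + e"] simp: A_closed D_closed)
next
  fix c y assume "y \<in> partners x"
  then obtain d where "y \<in> A" "d \<in> D" "\<forall>u\<in>A. \<forall>v\<in>A. d u v = wedge (s0 x) (s0 y) u v"
    unfolding partners_def by blast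
  moreover have "wedge (s0 x) (s0 (scale c y)) u v = c * wedge (s0 x) (s0 y) u v" for u v
    by (simp add: wedge_def s0_simps algebra_simps)
  ultimately show "scale c y \<in> partners x"
    unfolding partners_def using D_closed(3)[of d c]
    by (auto intro!: bexI[of _ "form_scale c d"] simp: A_closed form_scale_def)
qed

lemma self_partner: "x \<in> A \<Longrightarrow> x \<in> partners x"
  using D_closed(1) by (auto simp: partners_def wedge_def intro!: bexI[of _ 0])

text \<open>Adding a multiple of the rank two form \<open>e\<close> to \<open>s0 + d\<close> would put \<open>z\<close> into the radical.\<close>

lemma partner_orthogonal_solution:
  assumes "e \<in> D" "\<And>u v. u \<in> A \<Longrightarrow> v \<in> A \<Longrightarrow> e u v = wedge (s0 x) (s0 y) u v"
    and "d \<in> D" "z \<in> A" "\<And>a. a \<in> A \<Longrightarrow> s0 z a + d z a = s0 x a"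
  shows "s0 y z = 0"
proof (rule ccontr)
  assume c: "s0 y z \<noteq> 0"
  have "s0 x z = 0" using assms(4) assms(5)[of z] by (simp add: s0_simps D_simps[OF assms(3)])
  have "s0 z v + (d + form_scale (1 / s0 y z) e) z v = 0" if "v \<in> A" for v
  proof -
    have "e z v = - (s0 x v * s0 y z)"
      using assms(2)[OF assms(4) that] \<open>s0 x z = 0\<close> by (simp add: wedge_def)
    then show ?thesis
      using assms(5)[OF that, symmetric] c by (simp add: form_scale_def)
  qed
  then have "z = 0"
    using nondeg[of "d + form_scale (1 / s0 y z) e" z] assms D_closed by blast
  then show False using c by (simp add: s0_simps)
qed

text \<open>By nondegeneracy \<open>s0 x\<close> is nonzero on \<open>A\<close> and
  \<open>s0 y\<close> is no multiple of it there, so each of the two equations lowers the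
  dimension.\<close>

lemma dim_two_equations:
  assumes "x \<in> A" "y \<in> A" "x \<noteq> 0" "y \<notin> span {x}"
  shows "dim {a\<in>A. s0 x a = 0 \<and> s0 y a = 0} + 2 \<le> dim A"
proof -
  let ?Q = "{a\<in>A. s0 x a = 0 \<and> s0 y a = 0}" and ?H = "{a\<in>A. s0 x a = 0}"
  have sub: "subspace ?Q" "subspace ?H"
    by (rule subspaceI; auto simp: A_closed s0_simps)+
  have "?H \<noteq> A" using nondeg0[of x] assms by blast
  then have "dim ?H < dim A" using sub subspace_A by (intro dim_psubset_subspace) auto
  moreover have "?Q \<noteq> ?H"
  proof
    assume eq: "?Q = ?H"
    have "\<exists>c. \<forall>a\<in>A. s0 y a = (\<Sum>i\<in>{()}. c i * s0 x a)"
      by (rule functional_in_span_of_finite)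
        (use eq subspace_A alternating_linear[OF s0_alternating] in auto)
    then obtain c where c: "\<forall>a\<in>A. s0 y a = c * s0 x a" by auto
    have "y - scale c x = 0"
      using c assms by (intro nondeg0) (auto simp: A_closed s0_simps)
    then show False using assms(4) by (auto simp: span_singleton)
  qed
  then have "dim ?Q < dim ?H" using sub by (intro dim_psubset_subspace) auto
  ultimately show ?thesis by simp
qed

text \<open>For many scalars \<open>t\<close> the equation \<open>(t s0 + d) w = s0 x\<close> has a
  solution \<open>w t\<close> with \<open>s0 y (w t) = 0\<close>, which forces
  \<open>d (w t) y = 0\<close>. So \<open>d x y = 0\<close> as soon as \<open>x\<close> is a
  combination of these solutions. Otherwise a dimension count makes them dependent, and the relation
  shrinks to a single \<open>w t = 0\<close>, which is absurd.\<close>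

lemma partners_null:
  assumes "infinite (UNIV :: 'f set) \<or> card (UNIV :: 'f set) > dim A - 2"
    and "x \<in> A" "y \<in> partners x"
  shows "y \<in> null x" "s0 x y = 0"
proof -
  obtain e where e: "y \<in> A" "e \<in> D"
    "\<And>u v. u \<in> A \<Longrightarrow> v \<in> A \<Longrightarrow> e u v = wedge (s0 x) (s0 y) u v"
    using assms(3) unfolding partners_def by blast
  note orth = partner_orthogonal_solution[OF e(2) e(3)]
  have yx: "s0 y x = 0" using orth[OF _ _ D_closed(1) assms(2)] by simp
  then show "s0 x y = 0" using s0_skew[of x y] by simp
  have "d x y = 0" if d: "d \<in> D" for d
  proof (cases "x = 0 \<or> y \<in> span {x}")
    case True
    then show ?thesis by (auto simp: span_singleton D_simps[OF d])
  next
    case False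
    note D_s = D_simps[OF d]
    \<comment> \<open>Zero is excluded because each \<open>t\<close> is inverted below; the
      cardinality hypothesis leaves at least \<open>dim A - 2\<close> nonzero scalars.\<close>
    have "\<exists>T. T \<subseteq> UNIV - {0 :: 'f} \<and> finite T \<and> card T = dim A - 2"
    proof (cases "finite (UNIV :: 'f set)")
      case True
      then have "dim A - 2 \<le> card (UNIV - {0 :: 'f})" using assms(1) by simp
      then show ?thesis using obtain_subset_with_card_n by metis
    next
      case False
      then show ?thesis using infinite_arbitrarily_large[of "UNIV - {0 :: 'f}"] by auto
    qed
    then obtain T where "T \<subseteq> UNIV - {0 :: 'f}" and T: "finite T" "card T = dim A - 2"
      by (elim exE conjE)
    then have T0: "0 \<notin> T" by blast
    \<comment> \<open>Dividing a solution for \<open>s0 + d / t\<close> by \<open>t\<close> gives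
      one for \<open>t s0 + d\<close>, and \<open>orth\<close> makes it orthogonal to
      \<open>y\<close>.\<close>
    have "\<exists>z\<in>A. (\<forall>a\<in>A. t * s0 z a + d z a = s0 x a) \<and> s0 y z = 0" if "t \<in> T" for t
    proof -
      have t: "t \<noteq> 0" using T0 that by metis
      have mem: "form_scale (1 / t) d \<in> D" using D_closed d by blast
      obtain z where z: "z \<in> A" "\<And>a. a \<in> A \<Longrightarrow> s0 z a + form_scale (1 / t) d z a = s0 x a"
        by (rule represent[OF mem alternating_linear(1)[OF s0_alternating, of x]]) (rule that)
      then have "s0 y z = 0" using orth[OF _ _ mem z] by blast
      moreover have "t * s0 (scale (1 / t) z) a + d (scale (1 / t) z) a = s0 x a" if "a \<in> A" for a
        using z(2)[OF that] t by (simp add: s0_simps D_s form_scale_def)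
      ultimately show ?thesis
        using z(1) by (intro bexI[of _ "scale (1 / t) z"]) (auto simp: A_closed s0_simps)
    qed
    then obtain w where w: "\<And>t. t \<in> T \<Longrightarrow> w t \<in> A"
        "\<And>t a. t \<in> T \<Longrightarrow> a \<in> A \<Longrightarrow> t * s0 (w t) a + d (w t) a = s0 x a"
        "\<And>t. t \<in> T \<Longrightarrow> s0 y (w t) = 0"
      by metis
    define comb where "comb = (\<lambda>c. \<Sum>t\<in>T. scale (c t) (w t))"
    have combA: "comb c \<in> A" for c unfolding comb_def using w(1) by (intro A_closed) auto
    have dxy: ?thesis if "x = comb c" for c
    proof -
      have "d (w t) y = 0" if "t \<in> T" for t
        using w(2)[OF that e(1)] w(3)[OF that] \<open>s0 x y = 0\<close> s0_skew[of "w t" y] by simp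
      then show ?thesis unfolding that comb_def by (simp add: D_s)
    qed
    show ?thesis
    proof (rule ccontr)
      assume "d x y \<noteq> 0"
      then have no: "x \<noteq> comb c" for c using dxy by blast
      have multiple: "k = 0" if "comb c = scale k x" for c k
      proof (rule ccontr)
        assume "k \<noteq> 0"
        then have "x = scale (1 / k) (comb c)" using that by simp
        also have "\<dots> = comb (\<lambda>t. c t / k)" by (simp add: comb_def scale_sum_right)
        finally show False using no by blast
      qed
      define R where "R = {c. comb c = 0}"
      define Q where "Q = {a\<in>A. s0 x a = 0 \<and> s0 y a = 0}"
      have "s0 x (w t) = 0" if "t \<in> T" for t
        using w(2)[OF that w(1)[OF that]] by (simp add: s0_simps D_s)
      then have "w ` T \<subseteq> Q" using w by (auto simp: Q_def)
      moreover have "span {x} \<subseteq> Q"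
        using assms(2) yx by (auto simp: Q_def span_singleton A_closed s0_simps)
      moreover have "subspace Q"
        unfolding Q_def by (rule subspaceI) (auto simp: A_closed s0_simps)
      moreover have "dim Q < dim (span {x}) + card T"
        using dim_two_equations[OF assms(2) e(1)] False T(2) by (auto simp: Q_def)
      \<comment> \<open>All \<open>w t\<close> and \<open>x\<close> lie in \<open>Q\<close>, of
        dimension at most \<open>dim A - 2\<close>. So \<open>x\<close> and the
        \<open>dim A - 2\<close> solutions are one vector too many.\<close>
      ultimately obtain c t where c: "t \<in> T" "c t \<noteq> 0" "comb c \<in> span {x}"
        unfolding comb_def using family_relation_mod[OF T(1) subspace_span, of Q "{x}" w] by blast
      then have cR: "c \<in> R" using multiple by (force simp: R_def span_singleton)
      \<comment> \<open>Applying \<open>d\<close> to a relation and using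
        \<open>d (w t) = s0 x - t s0 (w t)\<close> shows that the combination with coefficients
        \<open>t * c t\<close> is a multiple of \<open>x\<close>. Since \<open>x\<close> is no
        combination of solutions, it is zero.\<close>
      have closed: "(\<lambda>t. (t - a) * c t) \<in> R" if "c \<in> R" for c a
      proof -
        define z where "z = comb (\<lambda>t. t * c t) - scale (\<Sum>t\<in>T. c t) x"
        have "z = 0"
        proof (rule nondeg0)
          show "z \<in> A" using combA assms(2) by (simp add: z_def A_closed)
          fix v assume v: "v \<in> A"
          have dw: "d (w t) v = s0 x v - t * s0 (w t) v" if "t \<in> T" for t
            using w(2)[OF that v] by (simp add: eq_diff_eq add.commute)
          have "0 = d (comb c) v" using that by (simp add: R_def D_s)
          also have "\<dots> = (\<Sum>t\<in>T. c t * (s0 x v - t * s0 (w t) v))"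
            unfolding comb_def D_s by (intro sum.cong) (auto simp: dw)
          also have "\<dots> = - s0 z v"
            by (simp add: z_def comb_def s0_simps algebra_simps sum_subtractf sum_distrib_left
              sum_distrib_right)
          finally show "s0 z v = 0" by simp
        qed
        then have "comb (\<lambda>t. t * c t) = 0" using multiple by (auto simp: z_def)
        moreover have "comb (\<lambda>t. (t - a) * c t) = comb (\<lambda>t. t * c t) - scale a (comb c)"
          by (simp only: comb_def scale_sum_right left_diff_distrib sum_subtractf
              scale_left_diff_distrib scale_scale)
        ultimately show ?thesis using that by (simp add: R_def)
      qed
      obtain c t where ct: "c \<in> R" "t \<in> T" "c t \<noteq> 0" "\<And>u. u \<in> T \<Longrightarrow> u \<noteq> t \<Longrightarrow> c u = 0"
        by (rule singleton_relation[OF T(1) closed cR c(1,2)], assumption) (rule that)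
      then have "comb c = scale (c t) (w t)"
        unfolding comb_def using T(1) by (subst sum.remove[of _ t]) auto
      then have "w t = 0" using ct by (simp add: R_def)
      then have "x = 0" using w(2)[OF ct(2)] assms(2) by (intro nondeg0) (auto simp: s0_simps D_s)
      then show False using False by blast
    qed
  qed
  then show "y \<in> null x" using e(1) by (simp add: null_def)
qed

end

section \<open>Splitting off a vector and the inductive dimension bound\<close>

context nondeg_family begin

text \<open>\<open>A'\<close> is a model inside \<open>A\<close> of the symplectic reduction: the
  hyperplane orthogonal to \<open>x\<close>, modulo the line of \<open>x\<close>.\<close>

definition splits :: "'v \<Rightarrow> 'v set \<Rightarrow> bool"
  where "splits x A' \<longleftrightarrow> subspace A' \<and> A' \<subseteq> A \<and> (\<forall>a\<in>A'. s0 x a = 0) \<and> x \<notin> A' \<and>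
    (\<forall>a\<in>A. s0 x a = 0 \<longrightarrow> (\<exists>k. a - scale k x \<in> A'))"

lemma splits_exists:
  assumes "x \<in> A" "x \<noteq> 0"
  obtains A' where "splits x A'" "dim A' + 2 = dim A"
proof -
  define H where "H = {a\<in>A. s0 x a = 0}"
  have H: "subspace H" unfolding H_def by (rule subspaceI) (auto simp: A_closed s0_simps)
  have "{x} \<subseteq> H" using assms by (simp add: H_def s0_simps)
  moreover have "independent {x}" using assms by simp
  ultimately obtain B where B: "{x} \<subseteq> B" "B \<subseteq> H" "independent B" "H \<subseteq> span B"
    using maximal_independent_subset_extend by metis
  have fin: "finite B" using B finiteI_independent by blast
  define A' where "A' = span (B - {x})"
  have "A' \<subseteq> H" unfolding A'_def using B H by (intro span_minimal) auto
  moreover have "x \<notin> A'" using B(1,3) by (auto simp: A'_def dependent_def)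
  moreover have "\<exists>k. a - scale k x \<in> A'" if "a \<in> A" "s0 x a = 0" for a
  proof -
    have "a \<in> span B" using that B by (auto simp: H_def)
    then have "a \<in> span (insert x (B - {x}))" using B(1) by (simp add: insert_absorb)
    then show ?thesis unfolding A'_def by (simp only: span_breakdown_eq)
  qed
  ultimately have "splits x A'" by (auto simp: splits_def A'_def H_def)
  moreover have "dim A' + 2 = dim A"
  proof -
    have dimH: "dim H = card B" using B basis_card_eq_dim by metis
    have "independent (B - {x})" using B(3) by (rule independent_mono) auto
    then have dimA': "dim A' = card B - 1"
      using B(1) fin by (simp add: A'_def dim_eq_card_independent)
    have "card B \<noteq> 0" using B(1) fin by auto
    obtain v where v: "v \<in> A" "s0 x v \<noteq> 0" using nondeg0[of x] assms by blast
    have "A \<subseteq> span (insert v H)"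
    proof
      fix a assume a: "a \<in> A"
      have "a - scale (s0 x a / s0 x v) v \<in> H"
        using a v by (simp add: H_def A_closed s0_simps)
      then show "a \<in> span (insert v H)" using span_base by (auto simp: span_breakdown_eq)
    qed
    then have "dim A \<le> dim (insert v H)" by (rule dim_mono)
    also have "\<dots> \<le> dim H + 1" by (simp add: dim_insert)
    finally have "dim A \<le> dim H + 1" .
    moreover have "H \<subset> A" using v by (auto simp: H_def)
    then have "dim H < dim A" using H subspace_A by (intro dim_psubset_subspace)
    ultimately show ?thesis using dimH dimA' \<open>card B \<noteq> 0\<close> by simp
  qed
  ultimately show ?thesis using that by blast
qed

lemma splits_decompose:
  assumes "splits x A'" "x \<in> A"
  obtains v where "v \<in> A" "s0 x v = 1"
    "\<And>b. b \<in> A \<Longrightarrow> \<exists>k. \<exists>b'\<in>A'. b = scale k x + b' + scale (s0 x b) v"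
proof -
  have "x \<noteq> 0" using assms(1) subspace_0 by (auto simp: splits_def)
  then obtain v0 where v0: "v0 \<in> A" "s0 x v0 \<noteq> 0" using nondeg0[of x] assms by blast
  define v where "v = scale (1 / s0 x v0) v0"
  have v: "v \<in> A" "s0 x v = 1" using v0 by (auto simp: v_def A_closed s0_simps)
  have "\<exists>k. \<exists>b'\<in>A'. b = scale k x + b' + scale (s0 x b) v" if b: "b \<in> A" for b
  proof -
    have "b - scale (s0 x b) v \<in> A" "s0 x (b - scale (s0 x b) v) = 0"
      using b v by (auto simp: A_closed s0_simps)
    then obtain k where "b - scale (s0 x b) v - scale k x \<in> A'"
      using assms(1) unfolding splits_def by blast
    then show ?thesis
      by (intro exI[of _ k] bexI[of _ "b - scale (s0 x b) v - scale k x"]) auto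
  qed
  then show ?thesis using that v by blast
qed

lemma subspace_stab: "forms.subspace (stab x)"
  unfolding stab_def by (rule forms.subspaceI) (auto simp: D_closed)

lemma stab_subset: "stab x \<subseteq> D"
  by (auto simp: stab_def)

text \<open>If \<open>a\<close> in \<open>A'\<close> is orthogonal to \<open>A'\<close> under
  \<open>s0 + d\<close>, then subtracting \<open>\<kappa> x\<close> makes it orthogonal to
  \<open>v\<close> too, hence to all of \<open>A\<close>. So \<open>a\<close> is a multiple of
  \<open>x\<close>, and it is zero because \<open>x\<close> is not in \<open>A'\<close>.\<close>

lemma splits_nondeg_family:
  assumes "splits x A'" "x \<in> A"
  shows "nondeg_family scale Basis A' s0 (stab x)"
proof
  show "subspace A'" using assms by (simp add: splits_def)
  show "s0 \<in> alternating_forms scale" by (rule s0_alternating)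
  show "stab x \<subseteq> alternating_forms scale" using stab_subset D_alternating by blast
  show "forms.subspace (stab x)" by (rule subspace_stab)
  fix d a assume "d \<in> stab x" and a: "a \<in> A'" and z: "\<And>b. b \<in> A' \<Longrightarrow> s0 a b + d a b = 0"
  then have d: "d \<in> D" "\<And>b. b \<in> A \<Longrightarrow> d x b = 0" by (auto simp: stab_def)
  note D_s = D_simps[OF d(1)]
  have A': "a \<in> A" "s0 x a = 0" using a assms by (auto simp: splits_def)
  then have ax: "s0 a x = 0" "d a x = 0"
    using s0_skew[of a x] D_skew[OF d(1), of a x] d(2) by auto
  obtain v where v: "v \<in> A" "s0 x v = 1"
    "\<And>b. b \<in> A \<Longrightarrow> \<exists>k. \<exists>b'\<in>A'. b = scale k x + b' + scale (s0 x b) v"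
    using splits_decompose[OF assms] by metis
  define \<kappa> where "\<kappa> = s0 a v + d a v"
  have "a - scale \<kappa> x = 0"
  proof (rule nondeg[OF d(1)])
    show "a - scale \<kappa> x \<in> A" using A' assms by (simp add: A_closed)
    fix b assume b: "b \<in> A"
    then obtain k b' where b': "b' \<in> A'" "b = scale k x + b' + scale (s0 x b) v"
      using v(3) by blast
    define l where "l = s0 x b"
    have bl: "b = scale k x + b' + scale l v" using b'(2) by (simp add: l_def)
    have "s0 a b + d a b = k * (s0 a x + d a x) + (s0 a b' + d a b') + l * \<kappa>"
      by (simp add: bl s0_simps D_s \<kappa>_def algebra_simps)
    also have "\<dots> = \<kappa> * s0 x b" using ax z[OF b'(1)] by (simp add: l_def)
    finally show "s0 (a - scale \<kappa> x) b + d (a - scale \<kappa> x) b = 0"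
      using d(2)[OF b] by (simp add: s0_simps D_s algebra_simps)
  qed
  then have eq: "a = scale \<kappa> x" by simp
  have "\<kappa> = 0"
  proof (rule ccontr)
    assume "\<kappa> \<noteq> 0"
    then have "x = scale (1 / \<kappa>) a" using eq by simp
    then have "x \<in> A'" using a assms subspace_scale by (metis splits_def)
    then show False using assms by (simp add: splits_def)
  qed
  then show "a = 0" using eq by simp
qed

text \<open>Three groups of evaluations suffice. The values of \<open>d x\<close> on a complement of
  \<open>null x\<close> decide whether \<open>d\<close> is in \<open>stab x\<close>; the set
  \<open>G\<close> then makes \<open>d\<close> vanish on \<open>A'\<close>; what survives is a form
  \<open>s0 x \<and> s0 y\<close> with \<open>y\<close> a partner in \<open>A'\<close>, which the
  pairs \<open>(v, e)\<close> detect.\<close>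

lemma determined_step:
  assumes "splits x A'" "x \<in> A" "determined (stab x) A' k"
  shows "determined D A (k + (dim A - dim (null x)) + (dim (partners x) - 1))"
proof -
  interpret sub: nondeg_family scale Basis A' s0 "stab x"
    by (rule splits_nondeg_family[OF assms(1,2)])
  have A': "A' \<subseteq> A" "\<And>a. a \<in> A' \<Longrightarrow> s0 x a = 0" "x \<notin> A'"
    using assms by (auto simp: splits_def)
  have "null x \<subseteq> A" by (auto simp: null_def)
  then obtain C where C: "finite C" "C \<subseteq> A" "card C = dim A - dim (null x)"
      "A \<subseteq> span (null x \<union> C)"
    using complement_basis[OF subspace_null _ subspace_A] by metis
  obtain G where G: "finite G" "card G \<le> k"
    "\<And>d. d \<in> stab x \<Longrightarrow> \<forall>(a, b)\<in>G. d a b = 0 \<Longrightarrow> \<forall>a\<in>A'. \<forall>b\<in>A'. d a b = 0"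
    using assms(3) unfolding determined_def by metis
  define Y where "Y = partners x \<inter> A'"
  have subY: "subspace Y"
    unfolding Y_def by (intro subspace_inter subspace_partners sub.subspace_A)
  \<comment> \<open>The vector \<open>x\<close> is its own partner but lies outside
    \<open>A'\<close>, which saves one evaluation.\<close>
  have "Y \<subset> partners x"
    using self_partner[OF assms(2)] A'(3) by (auto simp: Y_def)
  then have dimY: "dim Y \<le> dim (partners x) - 1"
    using dim_psubset_subspace[OF subY subspace_partners] by fastforce
  obtain E where E: "finite E" "card E \<le> dim Y" "\<And>y. y \<in> Y \<Longrightarrow> \<forall>a\<in>E. s0 y a = 0 \<Longrightarrow> y = 0" "E \<subseteq> A'"
    using separating_finite_subset[OF subY sub.subspace_A, of s0]
      alternating_linear[OF s0_alternating] sub.nondeg0 unfolding Y_def by (metis IntD2)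
  obtain v where v: "v \<in> A" "s0 x v = 1"
    "\<And>b. b \<in> A \<Longrightarrow> \<exists>k. \<exists>b'\<in>A'. b = scale k x + b' + scale (s0 x b) v"
    using splits_decompose[OF assms(1,2)] by metis
  let ?G = "G \<union> Pair x ` C \<union> Pair v ` E"
  have "d a b = 0" if d: "d \<in> D" and zero: "\<forall>(a, b)\<in>?G. d a b = 0" and "a \<in> A" "b \<in> A" for d a b
  proof -
    note D_s = D_simps[OF d]
    have "subspace {c. d x c = 0}" by (rule subspaceI) (auto simp: D_s)
    moreover have "null x \<union> C \<subseteq> {c. d x c = 0}" using zero d by (auto simp: null_def)
    ultimately have "span (null x \<union> C) \<subseteq> {c. d x c = 0}" using span_minimal by blast
    then have dx: "d x c = 0" if "c \<in> A" for c using that C(4) by blast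
    then have stab: "d \<in> stab x" using d by (simp add: stab_def)
    then have dA': "d a b = 0" if "a \<in> A'" "b \<in> A'" for a b
      using G(3)[OF stab] zero that by fastforce
    have expand: "d b1 b2 = s0 x b1 * d v b2' - s0 x b2 * d v b1'"
      if "b1 = scale k1 x + b1' + scale (s0 x b1) v" "b2 = scale k2 x + b2' + scale (s0 x b2) v"
        "b1' \<in> A'" "b2' \<in> A'" for b1 b2 k1 k2 b1' b2'
    proof -
      have "d y x = 0" if "y \<in> A" for y using D_skew[OF d, of y x] dx that by simp
      then show ?thesis
        using A'(1) that(3,4) v(1) D_skew[OF d, of b1' v]
        by (subst that(1), subst that(2)) (simp add: D_s dx dA' subset_iff algebra_simps)
    qed
    \<comment> \<open>By \<open>expand\<close>, only \<open>d v\<close> on \<open>A'\<close> is left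
      of \<open>d\<close>. Representing this functional by \<open>y\<close> turns \<open>d\<close>
      into the rank two form of \<open>x\<close> and \<open>y\<close>.\<close>
    obtain y where y: "y \<in> A'" "\<And>a. a \<in> A' \<Longrightarrow> s0 y a + 0 y a = d v a"
      by (rule sub.represent[OF sub.D_closed(1) alternating_linear(1)[of d scale v]])
        (use D_alternating d that in auto)
    have yx: "s0 y x = 0" using s0_skew[of y x] A'(2)[OF y(1)] by simp
    have "d b1 b2 = wedge (s0 x) (s0 y) b1 b2" if b: "b1 \<in> A" "b2 \<in> A" for b1 b2
    proof -
      obtain k1 b1' where 1: "b1' \<in> A'" "b1 = scale k1 x + b1' + scale (s0 x b1) v"
        using v(3)[OF b(1)] by blast
      obtain k2 b2' where 2: "b2' \<in> A'" "b2 = scale k2 x + b2' + scale (s0 x b2) v"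
        using v(3)[OF b(2)] by blast
      have yb: "s0 y b1 = s0 y b1' + s0 x b1 * s0 y v" "s0 y b2 = s0 y b2' + s0 x b2 * s0 y v"
        by (subst 1(2), simp add: s0_simps yx, subst 2(2), simp add: s0_simps yx)
      show ?thesis
        using expand[OF 1(2) 2(2) 1(1) 2(1)] y(2)[OF 1(1)] y(2)[OF 2(1)]
        by (simp add: wedge_def yb algebra_simps)
    qed
    then have "y \<in> Y" using y(1) A'(1) d by (auto simp: Y_def partners_def)
    moreover have "s0 y e = 0" if "e \<in> E" for e
      using y(2)[of e] bspec[OF zero, of "(v, e)"] that subsetD[OF E(4)] by simp
    ultimately have "y = 0" using E(3) by blast
    then have dv: "d v c = 0" if "c \<in> A'" for c using y(2)[OF that] by (simp add: s0_simps)
    obtain k1 b1' where 1: "b1' \<in> A'" "a = scale k1 x + b1' + scale (s0 x a) v"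
      using v(3)[OF \<open>a \<in> A\<close>] by blast
    obtain k2 b2' where 2: "b2' \<in> A'" "b = scale k2 x + b2' + scale (s0 x b) v"
      using v(3)[OF \<open>b \<in> A\<close>] by blast
    show ?thesis using expand[OF 1(2) 2(2) 1(1) 2(1)] dv 1 2 by simp
  qed
  moreover have "card ?G \<le> card G + card C + card E"
    using card_image_le[OF C(1), of "Pair x"] card_image_le[OF E(1), of "Pair v"]
      card_Un_le[of "G \<union> Pair x ` C" "Pair v ` E"] card_Un_le[of G "Pair x ` C"] by linarith
  moreover have "card G + card C + card E
      \<le> k + (dim A - dim (null x)) + (dim (partners x) - 1)"
    using G(2) C(3) E(2) dimY by linarith
  moreover have "finite ?G" using G C E by simp
  ultimately show ?thesis
    unfolding determined_def by (intro exI[of _ ?G]) (meson le_trans)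
qed

text \<open>If \<open>s0 x\<close> vanished on \<open>null x\<close>, the common kernel of all
  \<open>d x\<close>, it would equal some \<open>d x\<close> on \<open>A\<close>, and
  \<open>s0 - d\<close> would have \<open>x\<close> in its radical.\<close>

lemma dim_null_isotropic:
  assumes "x \<in> A" "x \<noteq> 0"
  shows "dim {a\<in>null x. s0 x a = 0} < dim (null x)"
proof (rule dim_psubset_subspace)
  show "subspace (null x)" by (rule subspace_null)
  show "subspace {a\<in>null x. s0 x a = 0}"
    unfolding null_def by (rule subspaceI) (auto simp: A_closed D_simps s0_simps)
  have "\<exists>a\<in>null x. s0 x a \<noteq> 0"
  proof (rule ccontr)
    assume no: "\<not> ?thesis"
    let ?Fs = "(\<lambda>d. d x) ` D"
    have "\<exists>d\<in>D. \<forall>a\<in>A. s0 x a = d x a"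
    proof (rule functional_in_family[OF subspace_A _ _ _ _ alternating_linear(1)[OF s0_alternating], of ?Fs])
      fix f assume "f \<in> ?Fs"
      then show "Vector_Spaces.linear scale (*) f"
        using D_alternating alternating_linear(1) by blast
    next
      fix f g assume "f \<in> ?Fs" "g \<in> ?Fs"
      then obtain d e where "d \<in> D" "f = d x" "e \<in> D" "g = e x" by blast
      then show "(\<lambda>z. f z + g z) \<in> ?Fs"
        by (intro image_eqI[of _ _ "d + e"]) (auto simp: D_closed)
    next
      fix f c assume "f \<in> ?Fs"
      then obtain d where "d \<in> D" "f = d x" by blast
      then show "(\<lambda>z. c * f z) \<in> ?Fs"
        by (intro image_eqI[of _ _ "form_scale c d"]) (auto simp: D_closed)
    next
      show "?Fs \<noteq> {}" using D_closed(1) by blast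
    next
      fix a assume "a \<in> A" "\<forall>f\<in>?Fs. f a = 0"
      then show "s0 x a = 0" using no by (auto simp: null_def)
    next
      fix f assume "f \<in> ?Fs" and f: "\<And>a. a \<in> A \<Longrightarrow> s0 x a = f a"
      then obtain d where "d \<in> D" "f = d x" by blast
      then show "\<exists>d\<in>D. \<forall>a\<in>A. s0 x a = d x a" using f by (intro bexI[of _ d]) auto
    qed
    then obtain d where d: "d \<in> D" "\<forall>a\<in>A. s0 x a = d x a" by blast
    have "x = 0"
      using D_closed(3)[OF d(1), of "-1"] d(2)
      by (intro nondeg[of "form_scale (-1) d"] assms) auto
    then show False using assms by simp
  qed
  then show "{a\<in>null x. s0 x a = 0} \<subset> null x" by blast
qed

lemma dim_partners:
  assumes "infinite (UNIV :: 'f set) \<or> card (UNIV :: 'f set) > dim A - 2"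
    and "x \<in> A" "x \<noteq> 0"
  shows "0 < dim (partners x)" "dim (partners x) < dim (null x)" "dim (null x) \<le> dim A"
proof -
  have "partners x \<subseteq> {a\<in>null x. s0 x a = 0}"
    using partners_null[OF assms(1,2)] by blast
  then show "dim (partners x) < dim (null x)"
    using dim_null_isotropic[OF assms(2,3)] dim_subset le_less_trans by blast
  have "dim {x} \<le> dim (partners x)"
    using self_partner[OF assms(2)] by (intro dim_subset) auto
  then show "0 < dim (partners x)" using assms(3) by simp
  show "dim (null x) \<le> dim A" by (intro dim_subset) (auto simp: null_def)
qed

end

text \<open>Since \<open>partners x\<close> is strictly smaller than \<open>null x\<close>,
  splitting off a vector from dimension \<open>2 m + 2\<close> costs at most \<open>2 m\<close>
  evaluations. These costs add up to \<open>m * (m - 1)\<close> at dimension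
  \<open>2 m\<close>.\<close>

lemma determined_bound:
  fixes scale :: "'f::field \<Rightarrow> 'v::ab_group_add \<Rightarrow> 'v"
  assumes "nondeg_family scale Basis A s0 D" "vector_space.dim scale A = 2 * m"
    and "infinite (UNIV :: 'f set) \<or> card (UNIV :: 'f set) > 2 * m - 2"
  shows "determined D A (m * (m - 1))"
  using assms
proof (induction m arbitrary: A D)
  case 0
  interpret nondeg_family scale Basis A s0 D by fact
  have "A \<subseteq> {0}" using 0(2) by simp
  then show ?case
    unfolding determined_def by (intro exI[of _ "{}"]) (auto simp: D_simps dest!: subsetD)
next
  case (Suc m)
  interpret nondeg_family scale Basis A s0 D by fact
  have "\<not> A \<subseteq> {0}" using Suc.prems(2) dim_eq_0[of A] by simp
  then obtain x where x: "x \<in> A" "x \<noteq> 0" by blast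
  then obtain A' where A': "splits x A'" "dim A' + 2 = dim A" using splits_exists by blast
  have "determined (stab x) A' (m * (m - 1))"
    using splits_nondeg_family[OF A'(1) x(1)] A'(2) Suc.prems by (intro Suc.IH) auto
  from determined_step[OF A'(1) x(1) this]
  show ?case
  proof (rule determined_mono)
    have "(dim A - dim (null x)) + (dim (partners x) - 1) \<le> 2 * m"
      using dim_partners[OF _ x] Suc.prems(2,3) by simp
    moreover have "m * (m - 1) + 2 * m = Suc m * (Suc m - 1)" by (cases m) auto
    ultimately show "m * (m - 1) + (dim A - dim (null x)) + (dim (partners x) - 1)
        \<le> Suc m * (Suc m - 1)" by simp
  qed
qed

section \<open>A symplectic affine space of dimension \<open>n (n - 1)\<close>\<close>

lemma alternating_formsI:
  assumes "vector_space scale" "\<And>x. s x x = 0"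
    "\<And>x y z. s (x + y) z = s x z + s y z" "\<And>c x z. s (scale c x) z = c * s x z"
    "\<And>x y z. s z (x + y) = s z x + s z y" "\<And>c x z. s z (scale c x) = c * s z x"
  shows "s \<in> alternating_forms scale"
  using assms by (auto simp: alternating_forms_def bilinear_form_def intro!: functionalI)

lemma wedge_alternating:
  assumes "vector_space scale" "Vector_Spaces.linear scale (*) f" "Vector_Spaces.linear scale (*) g"
  shows "wedge f g \<in> alternating_forms scale"
  using assms(1) by (rule alternating_formsI)
    (simp_all add: wedge_def functionalD[OF assms(2)] functionalD[OF assms(3)] algebra_simps)

lemma subspace_alternating_forms:
  assumes "vector_space scale"
  shows "forms.subspace (alternating_forms scale)"
proof (rule forms.subspaceI)
  show "0 \<in> alternating_forms scale" using assms by (rule alternating_formsI) simp_all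
next
  fix s t assume "s \<in> alternating_forms scale" "t \<in> alternating_forms scale"
  then show "s + t \<in> alternating_forms scale"
    by (intro alternating_formsI[OF assms])
      (simp_all add: alternating_simps[of s scale] alternating_simps[of t scale] algebra_simps)
next
  fix c s assume "s \<in> alternating_forms scale"
  then show "form_scale c s \<in> alternating_forms scale"
    by (intro alternating_formsI[OF assms])
      (simp_all add: alternating_simps[of s scale] algebra_simps)
qed

lemma affine_dimension_translate:
  assumes "forms.subspace D"
  shows "affine_dimension ((\<lambda>d. s + d) ` D) = forms.dim D"
proof -
  have "{u - v |u v. u \<in> (\<lambda>d. s + d) ` D \<and> v \<in> (\<lambda>d. s + d) ` D} = D" (is "?L = D")
  proof
    show "?L \<subseteq> D" using forms.subspace_diff[OF assms] by auto
    show "D \<subseteq> ?L"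
    proof
      fix d assume d: "d \<in> D"
      have "d = (s + d) - (s + 0)" by simp
      then show "d \<in> ?L" using d forms.subspace_0[OF assms] by blast
    qed
  qed
  then show ?thesis by (simp add: affine_dimension_def)
qed

lemma form_sum_apply: "(\<Sum>i\<in>I. F i) u v = (\<Sum>i\<in>I. F i u v)"
  for F :: "'i \<Rightarrow> 'v \<Rightarrow> 'v \<Rightarrow> 'f::field"
  by (induction I rule: infinite_finite_induct) auto

lemma card_below_antidiagonal:
  "card {(i, j). i < j \<and> j < 2 * n \<and> 2 * n \<le> i + j} = n * (n - 1)"
proof -
  have "{(i, j). i < j \<and> j < 2 * n \<and> 2 * n \<le> i + j}
      = prod.swap ` (SIGMA j:{..<2 * n}. {2 * n - j..<j})"
    by (auto simp: image_iff)
  \<comment> \<open>Truncated subtraction gives 0 for \<open>j \<le> n\<close>, in agreement with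
    the empty intervals there.\<close>
  then have "card {(i, j). i < j \<and> j < 2 * n \<and> 2 * n \<le> i + j} = (\<Sum>j<2 * n. 2 * j - 2 * n)"
    by (auto simp: card_image card_SigmaI intro!: sum.cong)
  also have "(\<Sum>j<n + k. 2 * j - 2 * n) = k * (k - 1)" for k
  proof (induction k)
    case (Suc k)
    then show ?case by (cases k) auto
  qed simp
  from this[of n] have "(\<Sum>j<2 * n. 2 * j - 2 * n) = n * (n - 1)" by (simp add: mult_2)
  finally show ?thesis .
qed

context finite_dimensional_vector_space begin

text \<open>In coordinates the forms have zeros above the antidiagonal, fixed nonzero entries on it and
  arbitrary entries below it.\<close>

lemma antitriangular_symplectic_space:
  assumes "dim UNIV = 2 * n"
  obtains T where "symplectic_affine_subspace scale T" "affine_dimension T = n * (n - 1)"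
proof -
  have "card Basis = 2 * n" using assms by simp
  then obtain b where b: "bij_betw b {..<2 * n} Basis"
    using ex_bij_betw_nat_finite[OF finite_Basis] by (auto simp: lessThan_atLeast0)
  define f where "f = (\<lambda>i x. representation Basis x (b i))"
  have lin: "Vector_Spaces.linear scale (*) (f i)" for i
    unfolding f_def using vector_space_axioms
    by (rule functionalI)
      (simp_all add: representation_add representation_scale independent_Basis span_Basis)
  have bB: "b i \<in> Basis" if "i < 2 * n" for i using b that by (auto simp: bij_betw_def)
  have fb: "f i (b j) = (if i = j then 1 else 0)" if "i < 2 * n" "j < 2 * n" for i j
  proof -
    have "b i = b j \<longleftrightarrow> i = j"
      using that inj_on_eq_iff[OF bij_betw_imp_inj_on[OF b], of i j] by simp
    then show ?thesis
      using representation_basis[OF independent_Basis bB[OF that(2)]] by (simp add: f_def)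
  qed
  have expand: "x = (\<Sum>i<2 * n. scale (f i x) (b i))" for x
  proof -
    have "(\<Sum>v\<in>Basis. scale (representation Basis x v) v) = x"
      by (rule sum_representation_eq[OF independent_Basis]) (auto simp: span_Basis finite_Basis)
    then show ?thesis
      using sum.reindex_bij_betw[OF b, of "\<lambda>v. scale (representation Basis x v) v"]
      by (simp add: f_def)
  qed
  define E where "E = (\<lambda>i j. wedge (f i) (f j))"
  have E_alt: "E i j \<in> alternating_forms scale" for i j
    unfolding E_def using vector_space_axioms lin by (intro wedge_alternating)
  have Eb: "E i j (b k) (b l) = (if i = k \<and> j = l then 1 else 0) - (if i = l \<and> j = k then 1 else 0)"
    if "i < 2 * n" "j < 2 * n" "k < 2 * n" "l < 2 * n" for i j k l
    unfolding E_def wedge_def fb[OF that(1,3)] fb[OF that(1,4)] fb[OF that(2,3)] fb[OF that(2,4)]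
    by (simp only: mult_1 mult_zero_left mult_zero_right if_distrib if_bool_eq_conj split: if_split) simp
  \<comment> \<open>The positions above the diagonal and strictly below the antidiagonal
    \<open>i + j = 2 n - 1\<close>: these are the free entries of an alternating matrix.\<close>
  define I where "I = {(i, j). i < j \<and> j < 2 * n \<and> 2 * n \<le> i + j}"
  define B where "B = (\<lambda>(i, j). E i j) ` I"
  have "I \<subseteq> {..<2 * n} \<times> {..<2 * n}" by (auto simp: I_def)
  then have finI: "finite I" using finite_subset by blast
  have EI: "E i j (b k) (b l) = (if (i, j) = (k, l) then 1 else 0)" if "(i, j) \<in> I" "(k, l) \<in> I" for i j k l
    using that by (subst Eb) (auto simp: I_def)
  have "inj_on (\<lambda>(i, j). E i j) I"
  proof (rule inj_onI, clarify)
    fix i j k l assume ij: "(i, j) \<in> I" "(k, l) \<in> I" and eq: "E i j = E k l"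
    have "E i j (b k) (b l) = 1" using EI[OF ij(2) ij(2)] by (simp add: eq)
    then show "i = k \<and> j = l" using EI[OF ij] by (simp split: if_splits)
  qed
  then have cardB: "card B = n * (n - 1)"
    using card_below_antidiagonal[of n] by (simp add: B_def card_image I_def)
  have indep: "forms.independent B"
  proof (rule forms.independent_if_scalars_zero)
    show "finite B" using finI by (simp add: B_def)
    fix g x assume zero: "(\<Sum>x\<in>B. form_scale (g x) x) = 0" and x: "x \<in> B"
    obtain k l where kl: "(k, l) \<in> I" "x = E k l" using x by (auto simp: B_def)
    have "0 = (\<Sum>x\<in>B. form_scale (g x) x) (b k) (b l)" using zero by simp
    also have "\<dots> = (\<Sum>y\<in>B. g y * y (b k) (b l))" by (simp add: form_sum_apply)
    also have "\<dots> = (\<Sum>y\<in>B. if y = x then g x else 0)"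
    proof (rule sum.cong)
      fix y assume "y \<in> B"
      then obtain i j where ij: "(i, j) \<in> I" "y = E i j" by (auto simp: B_def)
      show "g y * y (b k) (b l) = (if y = x then g x else 0)"
        using EI[OF ij(1) kl(1)] EI[OF kl(1) kl(1)] kl(2) ij(2) by auto
    qed simp
    also have "\<dots> = g x" using x \<open>finite B\<close> by simp
    finally show "g x = 0" by simp
  qed
  define D where "D = forms.span B"
  define s where "s = (\<Sum>i<n. E i (2 * n - 1 - i))"
  note sub = subspace_alternating_forms[OF vector_space_axioms]
  have s_alt: "s \<in> alternating_forms scale"
    unfolding s_def using sub E_alt by (intro forms.subspace_sum)
  have "B \<subseteq> alternating_forms scale" using E_alt by (auto simp: B_def)
  then have D_alt: "D \<subseteq> alternating_forms scale"
    unfolding D_def using sub by (rule forms.span_minimal)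
  have D_zero: "d (b i) (b j) = 0" if "d \<in> D" "i + j < 2 * n" for d i j
  proof -
    have "forms.subspace {d. d (b i) (b j) = 0}" by (rule forms.subspaceI) auto
    moreover have "B \<subseteq> {d. d (b i) (b j) = 0}"
      using that(2) by (auto simp: B_def I_def Eb)
    ultimately show ?thesis
      using that(1) forms.span_minimal unfolding D_def by blast
  qed
  have s_val: "s (b i) (b j) = (if i + j \<noteq> 2 * n - 1 then 0 else if i < n then 1 else - 1)"
    if "i < 2 * n" "j < 2 * n" for i j
  proof -
    have "s (b i) (b j) = (\<Sum>k<n. (if k = i then (if i + j = 2 * n - 1 then 1 else 0) else 0)
        - (if k = j then (if i + j = 2 * n - 1 then 1 else 0) else 0))"
      unfolding s_def form_sum_apply using that by (intro sum.cong) (auto simp: Eb)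
    also have "\<dots> = (if i + j \<noteq> 2 * n - 1 then 0 else if i < n then 1 else - 1)"
      using that by (auto simp: sum_subtractf)
    finally show ?thesis .
  qed
  have nd: "x = 0" if d: "d \<in> D" and zero: "\<And>y. (s + d) x y = 0" for d x
  proof (rule ccontr)
    assume "x \<noteq> 0"
    have alt: "s + d \<in> alternating_forms scale"
      using s_alt D_alt d forms.subspace_add[OF sub] by blast
    let ?K = "{i. i < 2 * n \<and> f i x \<noteq> 0}"
    have "?K \<noteq> {}"
    proof
      assume "?K = {}"
      then have "(\<Sum>i<2 * n. scale (f i x) (b i)) = 0" by (intro sum.neutral) auto
      then show False using expand[of x] \<open>x \<noteq> 0\<close> by simp
    qed
    \<comment> \<open>Test a supposed radical vector \<open>x\<close> against the basis vector with
      the index mirrored to its last nonzero coordinate. Indices below \<open>m\<close> meet zeros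
      of the matrix and indices above \<open>m\<close> have zero coordinate, so only the
      antidiagonal entry contributes.\<close>
    define m where "m = Max ?K"
    have "m \<in> ?K" unfolding m_def using \<open>?K \<noteq> {}\<close> by (intro Max_in) auto
    then have m: "m < 2 * n" "f m x \<noteq> 0" by auto
    have m_max: "i \<le> m" if "i < 2 * n" "f i x \<noteq> 0" for i
      unfolding m_def using that by (intro Max_ge) auto
    define j where "j = 2 * n - 1 - m"
    have j: "j < 2 * n" "m + j = 2 * n - 1" using m(1) by (auto simp: j_def)
    have "(s + d) x (b j) = (\<Sum>i<2 * n. f i x * (s + d) (b i) (b j))"
      by (subst expand[of x]) (simp only: alternating_simps(2,6)[OF alt])
    also have "\<dots> = (\<Sum>i<2 * n. if i = m then f m x * s (b m) (b j) else 0)"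
    proof (rule sum.cong)
      fix i assume "i \<in> {..<2 * n}"
      then have i: "i < 2 * n" by simp
      consider "i = m" | "i < m" | "i > m" by linarith
      then show "f i x * (s + d) (b i) (b j) = (if i = m then f m x * s (b m) (b j) else 0)"
      proof cases
        case 1
        then show ?thesis using D_zero[OF d, of i j] j m by simp
      next
        case 2
        then show ?thesis using D_zero[OF d, of i j] s_val[OF i j(1)] j by simp
      next
        case 3
        then show ?thesis using m_max[OF i] by fastforce
      qed
    qed simp
    also have "\<dots> = f m x * s (b m) (b j)" using m by simp
    also have "\<dots> \<noteq> 0" using m s_val[OF m(1) j(1)] j by simp
    finally show False using zero by blast
  qed
  define T where "T = (\<lambda>d. s + d) ` D"
  have "nondegenerate t" if "t \<in> T" for t
  proof -
    obtain d where d: "d \<in> D" "t = s + d" using \<open>t \<in> T\<close> by (auto simp: T_def)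
    have alt: "t \<in> alternating_forms scale"
      unfolding d(2) using s_alt D_alt d(1) forms.subspace_add[OF sub] by blast
    have "x = 0" if "\<And>y. t x y = 0" for x using nd[OF d(1)] that d(2) by blast
    then show ?thesis
      using alternating_skew[OF alt] unfolding nondegenerate_def by (metis neg_equal_0_iff_equal)
  qed
  moreover have "affine_subspace_alt scale T"
    unfolding affine_subspace_alt_def T_def using s_alt D_alt by (auto simp: D_def)
  ultimately have "symplectic_affine_subspace scale T"
    by (simp add: symplectic_affine_subspace_def)
  moreover have "affine_dimension T = n * (n - 1)"
    by (simp only: T_def D_def affine_dimension_translate[OF forms.subspace_span]
        forms.dim_span_eq_card_independent[OF indep] cardB)
  ultimately show ?thesis using that by blast
qed

end

text \<open>Each evaluation has a kernel of codimension at most one in \<open>D\<close>, so each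
  costs at most one spanning form. The finite spanning set makes \<open>forms.dim\<close> a genuine
  bound inside the possibly infinite-dimensional space of all functions.\<close>

lemma determined_span:
  fixes D :: "('v \<Rightarrow> 'v \<Rightarrow> 'f::field) set"
  assumes "forms.subspace D" "determined D UNIV k"
  obtains W where "finite W" "card W \<le> k" "D \<subseteq> forms.span W"
proof -
  have key: "\<exists>W. finite W \<and> card W \<le> card G \<and> D \<subseteq> forms.span W"
    if "finite G" "forms.subspace D" "\<And>d. d \<in> D \<Longrightarrow> \<forall>(a, b)\<in>G. d a b = 0 \<Longrightarrow> d = 0"
    for G :: "('v \<times> 'v) set" and D :: "('v \<Rightarrow> 'v \<Rightarrow> 'f) set"
    using that
  proof (induction G arbitrary: D rule: finite_induct)
    case empty
    then have "D \<subseteq> {0}" by blast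
    then have "D \<subseteq> forms.span {}" by (rule ord_le_eq_trans) (rule forms.span_empty[symmetric])
    then show ?case by (intro exI[of _ "{}"] conjI finite.emptyI) (simp_all only: card.empty)
  next
    case (insert p G)
    obtain a b where p: "p = (a, b)" by fastforce
    define D' where "D' = {d\<in>D. d a b = 0}"
    have "forms.subspace D'"
      unfolding D'_def by (rule forms.subspaceI)
        (auto simp: forms.subspace_0[OF insert.prems(1)] forms.subspace_add[OF insert.prems(1)]
          forms.subspace_scale[OF insert.prems(1)])
    moreover have "d = 0" if "d \<in> D'" "\<forall>(a, b)\<in>G. d a b = 0" for d
    proof (rule insert.prems(2))
      show "d \<in> D" using that(1) by (simp add: D'_def)
      show "\<forall>(a, b)\<in>insert p G. d a b = 0" using that by (auto simp: D'_def p)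
    qed
    ultimately obtain W where W: "finite W" "card W \<le> card G" "D' \<subseteq> forms.span W"
      using insert.IH[of D'] by blast
    show ?case
    proof (cases "D' = D")
      case True
      moreover have "card W \<le> card (insert p G)" using W(2) insert.hyps by simp
      ultimately show ?thesis using W(1,3) by blast
    next
      case False
      then obtain e where e: "e \<in> D" "e a b \<noteq> 0" by (auto simp: D'_def)
      have "D \<subseteq> forms.span (insert e W)"
      proof
        fix d assume "d \<in> D"
        then have "d - form_scale (d a b / e a b) e \<in> D'"
          using e by (simp add: D'_def forms.subspace_diff[OF insert.prems(1)]
              forms.subspace_scale[OF insert.prems(1)])
        then show "d \<in> forms.span (insert e W)"
          using W(3) by (auto simp: forms.span_breakdown_eq)
      qed
      moreover have "card (insert e W) \<le> card (insert p G)"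
        using W insert.hyps by (simp add: card_insert_if)
      ultimately show ?thesis using W(1) by (meson finite_insert)
    qed
  qed
  obtain G where "finite G" "card G \<le> k"
    "\<And>d. d \<in> D \<Longrightarrow> \<forall>(a, b)\<in>G. d a b = 0 \<Longrightarrow> \<forall>a\<in>UNIV. \<forall>b\<in>UNIV. d a b = 0"
    using assms(2) unfolding determined_def by metis
  moreover from this(3) have "d = 0" if "d \<in> D" "\<forall>(a, b)\<in>G. d a b = 0" for d
    using that by (auto simp: fun_eq_iff)
  ultimately show ?thesis using key[of G D] assms(1) that by (meson le_trans)
qed

section \<open>Irreducible optimal affine spaces\<close>

text \<open>Optimality enters as a lower bound on the number of evaluations that determine
  \<open>D\<close>, the form in which the counting arguments contradict it. Irreducibility is an
  elimination rule whose inclusion, required for all \<open>s\<close> and \<open>t\<close>, yields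
  equality of orthogonals.\<close>

locale irreducible_optimal_family = finite_dimensional_vector_space scale Basis
  for scale :: "'f::field \<Rightarrow> 'v::ab_group_add \<Rightarrow> 'v" and Basis +
  fixes n :: nat and S D :: "('v \<Rightarrow> 'v \<Rightarrow> 'f) set"
  assumes dim_space: "dim UNIV = 2 * n" and n_ge_2: "n \<ge> 2"
    and large_field: "infinite (UNIV :: 'f set) \<or> card (UNIV :: 'f set) > 2 * n - 2"
    and S_alternating: "S \<subseteq> alternating_forms scale"
    and D_alternating: "D \<subseteq> alternating_forms scale"
    and subspace_D: "forms.subspace D"
    and S_translate: "\<And>s. s \<in> S \<Longrightarrow> S = (\<lambda>d. s + d) ` D"
    and S_nonempty: "S \<noteq> {}"
    and S_nondegenerate: "\<And>s. s \<in> S \<Longrightarrow> nondegenerate s"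
    and D_optimal: "\<And>k. determined D UNIV k \<Longrightarrow> n * (n - 1) \<le> k"
    and S_irreducible: "\<And>W. subspace W \<Longrightarrow> W \<noteq> {0} \<Longrightarrow> (\<And>s. s \<in> S \<Longrightarrow> W \<subseteq> orthogonal_of s W) \<Longrightarrow>
      (\<And>s t. s \<in> S \<Longrightarrow> t \<in> S \<Longrightarrow> orthogonal_of s W \<subseteq> orthogonal_of t W) \<Longrightarrow> False"
begin

lemma nondeg_family: "s \<in> S \<Longrightarrow> nondeg_family scale Basis UNIV s D"
proof
  fix d x assume "s \<in> S" "d \<in> D" and zero: "\<And>y. y \<in> UNIV \<Longrightarrow> s x y + d x y = 0"
  then have "s + d \<in> S" using S_translate by blast
  then show "x = 0" using S_nondegenerate[of "s + d"] zero unfolding nondegenerate_def by auto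
qed (use S_alternating D_alternating subspace_D in auto)

lemma add_mem_S: "s \<in> S \<Longrightarrow> d \<in> D \<Longrightarrow> s + d \<in> S"
  using S_translate by blast

lemma diff_mem_D: "s \<in> S \<Longrightarrow> t \<in> S \<Longrightarrow> t - s \<in> D"
proof -
  assume "s \<in> S" "t \<in> S"
  then obtain d where "d \<in> D" "t = s + d" using S_translate by blast
  then show ?thesis by simp
qed

lemma S_simps:
  assumes "s \<in> S"
  shows "s (x + y) z = s x z + s y z" "s (scale c x) z = c * s x z" "s 0 z = 0"
    "s (x - y) z = s x z - s y z" "s (- x) z = - s x z" "s (sum g I) z = (\<Sum>i\<in>I. s (g i) z)"
    "s z (x + y) = s z x + s z y" "s z (scale c x) = c * s z x" "s z 0 = 0"
    "s z (x - y) = s z x - s z y" "s z (- x) = - s z x" "s z (sum g I) = (\<Sum>i\<in>I. s z (g i))"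
    "s x x = 0"
  using alternating_simps[OF subsetD[OF S_alternating assms]] by auto

lemma S_skew: "s \<in> S \<Longrightarrow> s x y = - s y x"
  using S_alternating alternating_skew by blast

section \<open>Vectors that are orthogonal under every form of the affine space\<close>

definition comm :: "'v \<Rightarrow> 'v \<Rightarrow> bool"
  where "comm x y \<longleftrightarrow> (\<forall>s\<in>S. s x y = 0)"

lemma comm_sym: "comm x y \<Longrightarrow> comm y x"
  unfolding comm_def using S_skew by (metis neg_equal_0_iff_equal)

lemma comm_self: "comm x x"
  by (simp add: comm_def S_simps)

lemma subspace_comm: "subspace {y. comm x y}"
  by (rule subspaceI) (auto simp: comm_def S_simps)

text \<open>From right to left this is \<open>partners_null\<close>. Conversely, a \<open>y\<close>
  orthogonal to \<open>x\<close> under all of \<open>S\<close> but not a partner of \<open>x\<close>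
  would leave a gap of two between the dimensions of \<open>partners x\<close> and
  \<open>null x\<close>, and one splitting step would beat the optimal count.\<close>

lemma comm_iff_wedge:
  assumes "s \<in> S"
  shows "comm x y \<longleftrightarrow> wedge (s x) (s y) \<in> D"
proof
  interpret nondeg_family scale Basis UNIV s D by (rule nondeg_family[OF assms])
  assume "wedge (s x) (s y) \<in> D"
  then have "y \<in> partners x" by (auto simp: partners_def)
  then have y: "y \<in> null x" "s x y = 0"
    using partners_null[of x y] large_field dim_space by auto
  show "comm x y" unfolding comm_def
  proof
    fix t assume "t \<in> S"
    then have "t - s \<in> D" by (rule diff_mem_D[OF assms])
    then have "(t - s) x y = 0" using y(1) unfolding null_def by blast
    then show "t x y = 0" using y(2) by simp
  qed
next
  interpret nondeg_family scale Basis UNIV s D by (rule nondeg_family[OF assms])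
  assume c: "comm x y"
  show "wedge (s x) (s y) \<in> D"
  proof (cases "x = 0")
    case True
    then have "wedge (s x) (s y) = 0" by (simp add: wedge_def fun_eq_iff s0_simps)
    then show ?thesis using D_closed by simp
  next
    case False
    define Z where "Z = {a\<in>null x. s x a = 0}"
    have "d x y = 0" if "d \<in> D" for d
      using c add_mem_S[OF assms that] assms unfolding comm_def by (metis add.left_neutral plus_fun_apply)
    then have "y \<in> Z" using c assms by (auto simp: Z_def null_def comm_def)
    have "y \<in> partners x"
    proof (rule ccontr)
      assume "y \<notin> partners x"
      moreover have "partners x \<subseteq> Z"
        using partners_null[of x] large_field dim_space by (auto simp: Z_def)
      ultimately have "partners x \<subset> Z" using \<open>y \<in> Z\<close> by blast
      moreover have "subspace Z"
        unfolding Z_def null_def by (rule subspaceI) (auto simp: D_simps s0_simps)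
      ultimately have "dim (partners x) < dim Z"
        by (intro dim_psubset_subspace subspace_partners)
      also have "dim Z < dim (null x)" unfolding Z_def using False by (intro dim_null_isotropic) auto
      \<comment> \<open>Two strict inclusions. The resulting count is
        \<open>m * (m - 1) + (2 * n - 3)\<close>, one short of \<open>n * (n - 1)\<close>.\<close>
      finally have lt: "dim (partners x) + 2 \<le> dim (null x)"
        using \<open>dim (partners x) < dim Z\<close> \<open>dim Z < dim (null x)\<close> by linarith
      have pos: "0 < dim (partners x)" "dim (null x) \<le> 2 * n"
        using dim_partners[of x] False large_field dim_space by auto
      obtain A' where A': "splits x A'" "dim A' + 2 = 2 * n"
        using splits_exists[of x] False dim_space by auto
      obtain m where m: "n = Suc m" using n_ge_2 by (cases n) auto
      have "determined (stab x) A' (m * (m - 1))"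
        using splits_nondeg_family[OF A'(1)] A'(2) large_field m
        by (intro determined_bound[of scale Basis A' s]) auto
      then have "determined D UNIV (m * (m - 1) + (2 * n - dim (null x)) + (dim (partners x) - 1))"
        using determined_step[OF A'(1)] dim_space by auto
      from D_optimal[OF this]
      have "n * (n - 1) \<le> m * (m - 1) + (2 * n - 3)" using lt pos by linarith
      moreover have "m * (m - 1) + (2 * n - 3) < n * (n - 1)"
        using m n_ge_2 by (cases m) auto
      ultimately show False by simp
    qed
    then obtain e where e: "e \<in> D" "\<And>u v. e u v = wedge (s x) (s y) u v"
      by (auto simp: partners_def)
    then have "e = wedge (s x) (s y)" by (simp add: fun_eq_iff)
    then show ?thesis using e by simp
  qed
qed

text \<open>Compare the pair \<open>z, w\<close> in \<open>s\<close> and in \<open>s + wedge (s x) (s y)\<close>.\<close>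

lemma comm_transfer:
  assumes "comm x y" "comm z w" "s \<in> S" "s x z \<noteq> 0" "s y z = 0" "s x w = 0"
  shows "comm y w"
proof -
  define t where "t = s + wedge (s x) (s y)"
  have t: "t \<in> S" unfolding t_def using comm_iff_wedge[OF assms(3)] assms(1,3) by (intro add_mem_S) auto
  have "s z w = 0" "t z w = 0" using assms(2,3) t by (auto simp: comm_def)
  then have "s x z * s y w = 0" using assms(6) by (simp add: t_def wedge_def)
  then have yw: "s y w = 0" using assms(4) by simp
  have "wedge (t z) (t w) - wedge (s z) (s w) = form_scale (s x z) (wedge (s y) (s w))"
    by (simp add: fun_eq_iff t_def wedge_def assms(5,6) yw algebra_simps)
  moreover have "wedge (t z) (t w) \<in> D" "wedge (s z) (s w) \<in> D"
    using comm_iff_wedge[OF t, of z w] comm_iff_wedge[OF assms(3), of z w] assms(2) by blast+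
  ultimately have "form_scale (s x z) (wedge (s y) (s w)) \<in> D"
    using forms.subspace_diff[OF subspace_D] by metis
  from forms.subspace_scale[OF subspace_D this, of "1 / s x z"]
  have "wedge (s y) (s w) \<in> D" using assms(4) by simp
  then show ?thesis using comm_iff_wedge[OF assms(3)] by blast
qed

text \<open>If some \<open>x\<close> related to \<open>w\<close> satisfies
  \<open>s x h \<noteq> 0\<close>, then any \<open>u\<close> related to \<open>h\<close> can be
  corrected by a multiple of \<open>h\<close> to be orthogonal to \<open>x\<close>, and
  \<open>comm_transfer\<close> relates it to \<open>w\<close>. If there is no such \<open>x\<close>,
  everything related to \<open>w\<close> is related to \<open>h\<close>.\<close>

lemma comm_comparable:
  assumes "comm w h"
  shows "{u. comm h u} \<subseteq> {u. comm w u} \<or> {u. comm w u} \<subseteq> {u. comm h u}"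
proof (cases "\<exists>s\<in>S. \<exists>x. comm w x \<and> s x h \<noteq> 0")
  case True
  then obtain s x where s: "s \<in> S" "comm w x" "s x h \<noteq> 0" by blast
  have "comm w u" if u: "comm h u" for u
  proof -
    define v where "v = u - scale (s x u / s x h) h"
    have "comm h v"
      using subspace_comm[of h] u comm_self[of h] unfolding v_def
      by (simp add: comm_def S_simps)
    moreover have "s x v = 0" using s by (simp add: v_def S_simps)
    moreover have "s w h = 0" using assms s(1) by (simp add: comm_def)
    ultimately have "comm w v" using comm_transfer[of x w h v s] comm_sym[OF s(2)] s by blast
    have "r w u = 0" if "r \<in> S" for r
    proof -
      have "r w v = 0" "r w h = 0" using \<open>comm w v\<close> assms that by (auto simp: comm_def)
      then show ?thesis using that by (simp add: v_def S_simps)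
    qed
    then show ?thesis by (simp add: comm_def)
  qed
  then show ?thesis by blast
next
  case False
  then have "comm h x" if "comm w x" for x
    using that comm_sym[of x h] unfolding comm_def by blast
  then show ?thesis by blast
qed

text \<open>With forms regarded as maps into the dual, \<open>g\<close> is the inverse of
  \<open>s\<close> composed with \<open>t\<close>.\<close>

lemma transport_exists:
  assumes "s \<in> S" "t \<in> S"
  obtains g where "\<And>x. s (g x) = t x"
proof -
  interpret nondeg_family scale Basis UNIV s D by (rule nondeg_family[OF assms(1)])
  have "\<exists>z. s z = t x" for x
  proof -
    obtain z where "\<And>a. s z a + 0 z a = t x a"
      by (rule represent[OF D_closed(1) alternating_linear(1)[of t scale x]])
        (use S_alternating assms(2) in auto)
    then show ?thesis by (auto simp: fun_eq_iff)
  qed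
  then show ?thesis using that by metis
qed

text \<open>The transport \<open>g\<close> is linear and injective, and it preserves the relation
  because \<open>wedge (t w) (t u)\<close> equals \<open>wedge (s z) (s (g u))\<close>; membership
  of this form in \<open>D\<close> means \<open>comm\<close> on both sides.\<close>

lemma dim_comm_transport:
  assumes "s \<in> S" "t \<in> S" "s z = t w"
  shows "dim {u. comm w u} \<le> dim {u. comm z u}"
proof -
  obtain g where g: "\<And>x. s (g x) = t x" using transport_exists[OF assms(1,2)] by metis
  have inj_s: "x = y" if "s x = s y" for x y
  proof -
    have "s (x - y) v = 0" for v using that assms(1) by (simp add: S_simps)
    then show ?thesis using S_nondegenerate[OF assms(1)] unfolding nondegenerate_def by fastforce
  qed
  have inj: "x = y" if "g x = g y" for x y
  proof -
    have "t x = t y" using g[of x] g[of y] that by simp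
    then have "t (x - y) v = 0" for v using assms(2) by (simp add: S_simps)
    then show ?thesis using S_nondegenerate[OF assms(2)] unfolding nondegenerate_def by fastforce
  qed
  have "Vector_Spaces.linear scale scale g"
    unfolding Vector_Spaces.linear_iff using vector_space_axioms
    by (auto intro!: inj_s simp: g fun_eq_iff S_simps[OF assms(1)] S_simps[OF assms(2)])
  moreover have "inj_on g (span {u. comm w u})" using inj by (simp add: inj_on_def)
  ultimately have "dim (g ` {u. comm w u}) = dim {u. comm w u}"
    using finite_dimensional_vector_space_pair_1.dim_image_eq[of scale Basis scale]
      finite_dimensional_vector_space_axioms vector_space_axioms
    by (simp add: finite_dimensional_vector_space_pair_1_def)
  moreover have "g ` {u. comm w u} \<subseteq> {u. comm z u}"
  proof clarify
    fix u assume "comm w u"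
    then have "wedge (t w) (t u) \<in> D" using comm_iff_wedge assms by blast
    then have "wedge (s z) (s (g u)) \<in> D" by (simp add: g assms(3))
    then show "comm z (g u)" using comm_iff_wedge assms by blast
  qed
  ultimately show ?thesis by (metis dim_subset)
qed

text \<open>Choose \<open>y\<close> whose related space \<open>Y\<close> is largest. The vectors of
  \<open>Y\<close> related to all of \<open>Y\<close> form a subspace \<open>W\<close>, and every
  nonzero one has related space exactly \<open>Y\<close>. By \<open>moved\<close>, transports
  preserve \<open>W\<close>; hence its orthogonal is the same under all forms, against
  irreducibility.\<close>

lemma comm_only_multiples:
  assumes "comm x0 y0" "x0 \<noteq> 0"
  shows "y0 \<in> span {x0}"
proof (rule ccontr)
  assume y0: "y0 \<notin> span {x0}"
  have "\<exists>y. y \<noteq> 0 \<and> (\<forall>z. z \<noteq> 0 \<longrightarrow> dim {u. comm z u} \<le> dim {u. comm y u})"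
    by (rule ex_has_greatest_nat[of "\<lambda>y. y \<noteq> 0" x0 "\<lambda>y. dim {u. comm y u}" "Suc (2 * n)"])
      (use assms dim_subset[OF subset_UNIV] dim_space in \<open>auto simp: less_Suc_eq_le\<close>)
  then obtain y where y: "y \<noteq> 0" "\<And>z. z \<noteq> 0 \<Longrightarrow> dim {u. comm z u} \<le> dim {u. comm y u}" by blast
  define Y where "Y = {u. comm y u}"
  have subY: "subspace Y" unfolding Y_def by (rule subspace_comm)
  have "span {x0} \<subset> {u. comm x0 u}"
    using y0 assms(1) comm_self span_minimal[OF _ subspace_comm, of "{x0}" x0] by blast
  then have "dim (span {x0}) < dim {u. comm x0 u}"
    by (intro dim_psubset_subspace subspace_comm) auto
  then have "1 < dim Y" using y(2)[OF assms(2)] assms(2) by (simp add: Y_def)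
  have second: "\<exists>u. comm z u \<and> u \<notin> span {z}" if "dim {u. comm z u} = dim Y" for z
  proof (rule ccontr)
    assume "\<not> ?thesis"
    then have "dim {u. comm z u} \<le> dim (span {z})" by (intro dim_subset) auto
    then show False using that \<open>1 < dim Y\<close> by (simp split: if_splits)
  qed
  have maximal: "{u. comm z u} = Y" if "z \<noteq> 0" "Y \<subseteq> {u. comm z u}" for z
    using subspace_dim_equal[OF subY subspace_comm that(2)] y(2)[OF that(1)] by (simp add: Y_def)
  \<comment> \<open>The related spaces of \<open>w\<close> and \<open>h\<close> are comparable, and
    by maximality the one of \<open>h\<close> cannot properly contain \<open>Y\<close>.\<close>
  have below: "{u. comm h u} \<subseteq> Y" if "h \<in> Y" "h \<noteq> 0" "{u. comm w u} = Y" for h w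
    using comm_comparable[of w h] maximal[OF that(2)] that by blast
  have moved: "{u. comm z u} = Y"
    if s: "s \<in> S" "t \<in> S" "s z = t w" and w: "w \<noteq> 0" "{u. comm w u} = Y" for s t z w
  proof -
    have "z \<noteq> 0"
    proof
      assume "z = 0"
      then have "t w v = 0" for v using s S_simps(3)[OF s(1)] by metis
      then show False using S_nondegenerate[OF s(2)] w(1) unfolding nondegenerate_def by blast
    qed
    then have dimz: "dim {u. comm z u} = dim Y"
      using dim_comm_transport[OF s] w(2) y(2) by (metis Y_def le_antisym)
    have szY: "s z u = 0" if "u \<in> Y" for u using that s w(2) by (auto simp: comm_def)
    have "w \<in> Y" using comm_self w(2) by blast
    show ?thesis
    proof (cases "z \<in> Y")
      case True
      then show ?thesis
        using subspace_dim_equal[OF subspace_comm subY below[OF _ \<open>z \<noteq> 0\<close> w(2)]] dimz by simp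
    next
      case False
      \<comment> \<open>Such an \<open>h\<close> gives a contradiction: by \<open>below\<close>
        everything related to \<open>h\<close>, in particular \<open>z\<close>, lies in
        \<open>Y\<close>.\<close>
      have "\<exists>h. h \<noteq> 0 \<and> h \<in> Y \<and> comm z h"
      proof (cases "\<exists>r\<in>S. \<exists>x\<in>Y. r w z = 0 \<and> r x z \<noteq> 0")
        case True
        then obtain r x where r: "r \<in> S" "x \<in> Y" "r w z = 0" "r x z \<noteq> 0" by blast
        obtain u where u: "comm z u" "u \<notin> span {z}" using second dimz by blast
        define h where "h = u - scale (r x u / r x z) z"
        have "h \<noteq> 0" using u(2) by (auto simp: h_def span_singleton)
        moreover have "comm z h" using u(1) by (simp add: h_def comm_def S_simps)
        moreover have "r x h = 0" using r by (simp add: h_def S_simps)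
        ultimately have "comm w h"
          using comm_transfer[of x w z h r] r comm_sym[of w x] w(2) by blast
        then show ?thesis using \<open>h \<noteq> 0\<close> \<open>comm z h\<close> w(2) by blast
      next
        case False
        obtain u where u: "comm w u" "u \<notin> span {w}" using second w(2) by blast
        obtain r where r: "r \<in> S" "r w z \<noteq> 0"
          using \<open>z \<notin> Y\<close> w(2) unfolding comm_def by blast
        define h where "h = u - scale (r u z / r w z) w"
        have "h \<noteq> 0" using u(2) by (auto simp: h_def span_singleton)
        have "h \<in> Y"
        proof -
          have "u \<in> Y" using u(1) w(2) by blast
          then show ?thesis
            using \<open>w \<in> Y\<close> subY unfolding h_def by (intro subspace_diff subspace_scale)
        qed
        have rh: "r h z = 0" using r by (simp add: h_def S_simps)
        have sh: "s h z = 0" "s w z = 0"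
          using szY[OF \<open>h \<in> Y\<close>] szY[OF \<open>w \<in> Y\<close>] S_skew[OF s(1), of _ z] by auto
        have "comm h z" unfolding comm_def
        proof
          fix q assume q: "q \<in> S"
          \<comment> \<open>The correction by a multiple of \<open>r - s\<close> makes
            \<open>w\<close> and \<open>z\<close> orthogonal, since \<open>s w z = 0\<close>, and
            leaves the value at \<open>h\<close>, \<open>z\<close> unchanged, since \<open>r\<close>
            and \<open>s\<close> both vanish there. The case assumption then applies to
            \<open>q'\<close>.\<close>
          define q' where "q' = q + form_scale (- q w z / r w z) (r - s)"
          have "q' \<in> S"
            unfolding q'_def
            by (intro add_mem_S forms.subspace_scale[OF subspace_D] diff_mem_D q r(1) s(1))
          moreover have "q' w z = 0" using r sh by (simp add: q'_def)
          ultimately have "q' h z = 0" using False \<open>h \<in> Y\<close> by blast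
          then show "q h z = 0" using rh sh by (simp add: q'_def)
        qed
        then show ?thesis using \<open>h \<noteq> 0\<close> \<open>h \<in> Y\<close> comm_sym by blast
      qed
      then obtain h where h: "h \<noteq> 0" "h \<in> Y" "comm z h" by blast
      then have "z \<in> Y" using below[OF h(2,1) w(2)] comm_sym by blast
      then show ?thesis using False by simp
    qed
  qed
  define W where "W = {h\<in>Y. \<forall>u\<in>Y. comm h u}"
  have W_Y: "{u. comm w u} = Y" if "w \<in> W" "w \<noteq> 0" for w
    using that maximal by (auto simp: W_def)
  show False
  proof (rule S_irreducible)
    have "W = Y \<inter> (\<Inter>u\<in>Y. {h. comm u h})" using comm_sym by (auto simp: W_def)
    then show "subspace W" by (simp add: subspace_inter subspace_Int subY subspace_comm)
    have "y \<in> W" using comm_self by (simp add: W_def Y_def)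
    then show "W \<noteq> {0}" using y(1) by blast
    show "W \<subseteq> orthogonal_of s W" if "s \<in> S" for s
      using that by (auto simp: W_def orthogonal_of_def comm_def)
    show "orthogonal_of s W \<subseteq> orthogonal_of t W" if st: "s \<in> S" "t \<in> S" for s t
    proof
      fix u assume u: "u \<in> orthogonal_of s W"
      have "t w u = 0" if w: "w \<in> W" for w
      proof (cases "w = 0")
        case True
        then show ?thesis using st by (simp add: S_simps)
      next
        case False
        obtain g where g: "\<And>x. s (g x) = t x" using transport_exists[OF st] by metis
        have "{u. comm (g w) u} = Y" using moved[OF st g False W_Y[OF w False]] .
        then have "g w \<in> W" using comm_self unfolding W_def by blast
        then have "s (g w) u = 0" using u by (simp add: orthogonal_of_def)
        then show ?thesis by (simp add: g)
      qed
      then show "u \<in> orthogonal_of t W" by (simp add: orthogonal_of_def)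
    qed
  qed
qed

end

section \<open>The spread of planes and the quadratic endomorphism\<close>

lemma (in finite_dimensional_vector_space) dim_span_pair:
  assumes "x \<noteq> 0" "y \<notin> span {x}"
  shows "dim (span {x, y}) = 2"
proof -
  have "dim (insert y {x}) = 2" using assms by (simp add: dim_insert)
  then show ?thesis by (simp only: dim_span insert_commute)
qed

section \<open>Planes as common orthogonals under the translation space\<close>

context irreducible_optimal_family begin

lemma D_simps:
  assumes "d \<in> D"
  shows "d (x + y) z = d x z + d y z" "d (scale c x) z = c * d x z" "d 0 z = 0"
    "d (x - y) z = d x z - d y z" "d (- x) z = - d x z" "d (sum g I) z = (\<Sum>i\<in>I. d (g i) z)"
    "d z (x + y) = d z x + d z y" "d z (scale c x) = c * d z x" "d z 0 = 0"
    "d z (x - y) = d z x - d z y" "d z (- x) = - d z x" "d z (sum g I) = (\<Sum>i\<in>I. d z (g i))"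
    "d x x = 0"
  using alternating_simps[OF subsetD[OF D_alternating assms]] by auto

lemma D_skew: "d \<in> D \<Longrightarrow> d x y = - d y x"
  using D_alternating alternating_skew by blast

text \<open>The orthogonal is taken under \<open>D\<close>, not \<open>S\<close>. It is
  two-dimensional for nonzero \<open>x\<close> only; \<open>plane 0\<close> is the whole
  space.\<close>

definition plane :: "'v \<Rightarrow> 'v set"
  where "plane x = {y. \<forall>d\<in>D. d x y = 0}"

lemma planeD: "y \<in> plane x \<Longrightarrow> d \<in> D \<Longrightarrow> d x y = 0"
  by (simp add: plane_def)

lemma subspace_plane: "subspace (plane x)"
  unfolding plane_def by (rule subspaceI) (auto simp: D_simps)

lemma self_plane: "x \<in> plane x"
  by (simp add: plane_def D_simps)

lemma plane_sym:
  assumes "y \<in> plane x"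
  shows "x \<in> plane y"
proof -
  have "d y x = 0" if "d \<in> D" for d
    using planeD[OF assms that] D_skew[OF that, of y x] by simp
  then show ?thesis by (simp add: plane_def)
qed

text \<open>Forms in \<open>S\<close> differ by elements of \<open>D\<close>, which vanish on the
  pair \<open>x\<close>, \<open>y\<close>; so orthogonality under one form of \<open>S\<close> gives
  orthogonality under all.\<close>

lemma plane_isotropic:
  assumes "s \<in> S" "x \<noteq> 0" "y \<in> plane x" "s x y = 0"
  shows "y \<in> span {x}"
proof (rule comm_only_multiples[OF _ assms(2)])
  show "comm x y" unfolding comm_def
  proof
    fix t assume "t \<in> S"
    then have "t - s \<in> D" using assms(1) diff_mem_D by blast
    then have "(t - s) x y = 0" by (rule planeD[OF assms(3)])
    then show "t x y = 0" using assms(4) by simp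
  qed
qed

text \<open>The functional \<open>s x\<close> is nonzero on \<open>plane x\<close>, and its kernel
  there is the line of \<open>x\<close>.\<close>

lemma dim_plane:
  assumes "x \<noteq> 0"
  shows "dim (plane x) = 2"
proof -
  obtain s where s: "s \<in> S" using S_nonempty by blast
  interpret nondeg_family scale Basis UNIV s D by (rule nondeg_family[OF s])
  have null: "null x = plane x" by (auto simp: null_def plane_def)
  have iso: "{a\<in>plane x. s x a = 0} = span {x}"
  proof
    show "{a\<in>plane x. s x a = 0} \<subseteq> span {x}" using plane_isotropic[OF s assms] by blast
    show "span {x} \<subseteq> {a\<in>plane x. s x a = 0}"
      using subspace_scale[OF subspace_plane self_plane] by (auto simp: span_singleton s0_simps)
  qed
  have lt: "1 < dim (plane x)"
    using dim_null_isotropic[of x] assms unfolding null iso by (simp add: dim_span)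
  then have "\<not> plane x \<subseteq> span {x}"
    using dim_subset[of "plane x" "span {x}"] assms by auto
  then obtain v where v: "v \<in> plane x" "s x v \<noteq> 0" using iso by blast
  have "plane x \<subseteq> span (insert v {x})"
  proof
    fix a assume "a \<in> plane x"
    then have "a - scale (s x a / s x v) v \<in> {a\<in>plane x. s x a = 0}"
      using v subspace_plane by (simp add: s0_simps subspace_diff subspace_scale)
    then show "a \<in> span (insert v {x})" unfolding iso span_breakdown_eq by blast
  qed
  then have "dim (plane x) \<le> card (insert v {x})" by (intro dim_le_card) auto
  also have "\<dots> \<le> 2" by (simp add: card_insert_if)
  finally show ?thesis using lt by simp
qed

lemma plane_second:
  assumes "x \<noteq> 0"
  obtains y where "y \<in> plane x" "y \<notin> span {x}"
proof -
  have "\<not> plane x \<subseteq> span {x}"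
    using dim_plane[OF assms] dim_subset[of "plane x" "span {x}"] assms by auto
  then show ?thesis using that by blast
qed

lemma plane_eq_span:
  assumes "x \<noteq> 0" "y \<in> plane x" "y \<notin> span {x}"
  shows "plane x = span {x, y}"
proof -
  have sub: "span {x, y} \<subseteq> plane x"
    using assms(2) self_plane subspace_plane by (intro span_minimal) auto
  have "dim (span {x, y}) = 2"
    using assms by (intro dim_span_pair)
  then show ?thesis
    using subspace_dim_equal[OF subspace_span subspace_plane sub] dim_plane[OF assms(1)] by simp
qed

lemma plane_elem:
  assumes "x \<noteq> 0" "y \<in> plane x" "y \<notin> span {x}" "z \<in> plane x"
  obtains k l where "z = scale k x + scale l y"
proof -
  have "z \<in> span (insert x {y})" using assms plane_eq_span by auto
  then obtain k l where "z - scale k x = scale l y"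
    unfolding span_breakdown_eq span_singleton by blast
  then have "z = scale k x + scale l y" by (simp add: algebra_simps)
  then show ?thesis by (rule that)
qed

text \<open>For independent \<open>x\<close> and \<open>y\<close> both planes equal
  \<open>span {x, y}\<close>. Hence the planes of nonzero vectors coincide or meet only in
  0.\<close>

lemma plane_eq:
  assumes "y \<in> plane x" "x \<noteq> 0" "y \<noteq> 0"
  shows "plane y = plane x"
proof (cases "y \<in> span {x}")
  case True
  then obtain k where "y = scale k x" by (auto simp: span_singleton)
  then show ?thesis using assms by (auto simp: plane_def D_simps)
next
  case False
  have "x \<notin> span {y}"
  proof
    assume "x \<in> span {y}"
    then obtain k where k: "x = scale k y" by (auto simp: span_singleton)
    then have "y = scale (1 / k) x" using assms(2) by auto
    then show False using False by (auto simp: span_singleton)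
  qed
  then show ?thesis
    using plane_eq_span[OF assms(2,1) False] plane_eq_span[OF assms(3) plane_sym[OF assms(1)]]
    by (simp add: insert_commute)
qed

lemma planes_meet:
  assumes "x \<noteq> 0" "y \<noteq> 0" "y \<notin> plane x" "z \<in> plane x" "z \<in> plane y"
  shows "z = 0"
  using plane_eq[of z x] plane_eq[of z y] assms self_plane by metis

text \<open>Otherwise the planes of \<open>t x + y\<close>, for sufficiently many \<open>t\<close>, would not fit into the hyperplane
  orthogonal to \<open>y\<close> under \<open>e\<close>.\<close>

lemma stabilizer_plane:
  assumes "x \<noteq> 0" "x' \<in> plane x" "e \<in> D" "\<And>v. e x v = 0"
  shows "e x' y = 0"
proof (rule ccontr)
  assume ne: "e x' y \<noteq> 0"
  note e_s = D_simps[OF assms(3)]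
  have ex: "e v x = 0" for v using D_skew[OF assms(3), of v x] assms(4) by simp
  have x': "x' \<notin> span {x}" using ne by (auto simp: span_singleton e_s assms(4))
  have y: "y \<notin> plane x"
  proof
    assume "y \<in> plane x"
    then obtain k l where "y = scale k x + scale l x'" by (rule plane_elem[OF assms(1,2) x'])
    then show False using ne by (simp add: e_s ex)
  qed
  have y0: "y \<noteq> 0" using ne by (auto simp: e_s)
  have iso: "v \<in> span {x}" if v: "v \<in> plane x" "e y v = 0" for v
  proof (rule ccontr)
    assume "v \<notin> span {x}"
    then obtain k l where "x' = scale k x + scale l v" by (rule plane_elem[OF assms(1) v(1) _ assms(2)])
    then have "e y x' = 0" using v(2) by (simp add: e_s ex)
    then show False using ne D_skew[OF assms(3), of x' y] by simp
  qed
  define U where "U = span {x, y}"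
  have U: "subspace U" "x \<in> U" "y \<in> U" unfolding U_def by (auto intro: span_base)
  have yx: "y \<notin> span {x}"
    using y subspace_scale[OF subspace_plane self_plane] by (auto simp: span_singleton)
  have dimU: "dim U = 2"
    unfolding U_def using assms(1) yx by (rule dim_span_pair)
  define z where "z = (\<lambda>t. scale t x + y)"
  have "z t \<in> U" for t using U by (simp add: z_def subspace_add subspace_scale)
  have z0: "z t \<noteq> 0" for t
  proof
    assume "z t = 0"
    then have "y = scale (- t) x" by (simp add: z_def add_eq_0_iff)
    then show False using yx unfolding span_singleton by blast
  qed
  have "\<exists>w. w \<in> plane (z t) \<and> w \<notin> span {z t}" for t using plane_second[OF z0] by metis
  then obtain w where w: "\<And>t. w t \<in> plane (z t)" "\<And>t. w t \<notin> span {z t}" by metis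
  \<comment> \<open>Otherwise the plane of \<open>z t\<close> would be \<open>U\<close> and contain
    \<open>x\<close>, so \<open>z t\<close> and then \<open>y\<close> would lie in
    \<open>plane x\<close>.\<close>
  have wU: "w t \<notin> U" for t
  proof
    assume "w t \<in> U"
    then have "plane (z t) \<subseteq> U"
      using plane_eq_span[OF z0 w] \<open>z t \<in> U\<close> U(1) span_minimal[of "{z t, w t}" U] by simp
    then have "plane (z t) = U"
      using subspace_dim_equal[OF subspace_plane U(1)] dimU dim_plane[OF z0] by simp
    then have "z t \<in> plane x" using U(2) plane_sym by blast
    then have "z t - scale t x \<in> plane x"
      using subspace_diff subspace_scale subspace_plane self_plane by blast
    then show False using y by (simp add: z_def)
  qed
  have dw: "d y (w t) = - t * d x (w t)" if "d \<in> D" for d t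
    using planeD[OF w(1) that, of t] by (simp add: z_def D_simps[OF that] eq_neg_iff_add_eq_0 add.commute)
  have ew: "e y (w t) = 0" for t using dw[OF assms(3)] assms(4) by simp
  define Q where "Q = {v. e y v = 0}"
  have Q: "subspace Q" unfolding Q_def by (rule subspaceI) (auto simp: e_s)
  have "x' \<notin> Q" using ne D_skew[OF assms(3), of x' y] by (simp add: Q_def)
  then have "dim Q < 2 * n"
    using dim_psubset_subspace[OF Q subspace_UNIV] dim_space by auto
  have "\<exists>T :: 'f set. finite T \<and> card T = 2 * n - 2"
  proof (cases "finite (UNIV :: 'f set)")
    case True
    then have "2 * n - 2 \<le> card (UNIV :: 'f set)" using large_field by simp
    then show ?thesis using obtain_subset_with_card_n[of "2 * n - 2" "UNIV :: 'f set"] by metis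
  next
    case False
    then show ?thesis using infinite_arbitrarily_large[of "UNIV :: 'f set" "2 * n - 2"] by blast
  qed
  then obtain T :: "'f set" where T: "finite T" "card T = 2 * n - 2" by blast
  have "U \<subseteq> Q" unfolding U_def using Q by (intro span_minimal) (auto simp: Q_def e_s ex)
  moreover have "w ` T \<subseteq> Q" using ew by (auto simp: Q_def)
  moreover have "dim Q < dim U + card T" using \<open>dim Q < 2 * n\<close> T(2) dimU by simp
  ultimately obtain c t where ct: "t \<in> T" "c t \<noteq> 0" "(\<Sum>t\<in>T. scale (c t) (w t)) \<in> U"
    by (rule family_relation_mod[OF T(1) U(1) Q]) (rule that)
  define R where "R = {c. (\<Sum>t\<in>T. scale (c t) (w t)) \<in> U}"
  \<comment> \<open>By \<open>dw\<close>, weighting the coefficients by \<open>t\<close> turns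
    \<open>d x\<close> into \<open>- d y\<close>. So \<open>v\<close> differs from a multiple of
    \<open>y\<close> by an element of \<open>plane x\<close> that \<open>e y\<close> kills, and
    \<open>iso\<close> puts this element on the line of \<open>x\<close>.\<close>
  have closed: "(\<lambda>t. (t - a) * c t) \<in> R" if c: "c \<in> R" for c a
  proof -
    define u where "u = (\<Sum>t\<in>T. scale (c t) (w t))"
    define v where "v = (\<Sum>t\<in>T. scale (t * c t) (w t))"
    have "u \<in> span (insert x {y})" using c by (simp add: u_def R_def U_def)
    then obtain k l where "u - scale k x = scale l y"
      unfolding span_breakdown_eq span_singleton by blast
    then have u: "u = scale k x + scale l y" by (simp add: algebra_simps)
    have "d x (v - scale k y) = 0" if d: "d \<in> D" for d
    proof -
      note d_s = D_simps[OF d]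
      have "d x v = - d y u"
        unfolding u_def v_def by (simp add: d_s dw[OF d] sum_negf[symmetric] mult_ac)
      also have "\<dots> = k * d x y" using D_skew[OF d, of x y] by (simp add: u d_s)
      finally show ?thesis by (simp add: d_s)
    qed
    then have "v - scale k y \<in> plane x" by (simp add: plane_def)
    moreover have "e y (v - scale k y) = 0" by (simp add: v_def e_s ew)
    ultimately have "v - scale k y \<in> span {x}" by (rule iso)
    then have "v - scale k y \<in> U" using U by (auto simp: span_singleton subspace_scale)
    then have "v - scale k y + scale k y \<in> U" using U by (intro subspace_add subspace_scale)
    then have "v \<in> U" by simp
    then have "v - scale a u \<in> U"
      using c U(1) by (intro subspace_diff subspace_scale) (auto simp: u_def R_def)
    also have "v - scale a u = (\<Sum>t\<in>T. scale ((t - a) * c t) (w t))"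
      by (simp only: u_def v_def scale_sum_right left_diff_distrib sum_subtractf
          scale_left_diff_distrib scale_scale)
    finally show ?thesis by (simp add: R_def)
  qed
  have cR: "c \<in> R" using ct(3) by (simp add: R_def)
  obtain c t where c: "c \<in> R" "t \<in> T" "c t \<noteq> 0" "\<And>u. u \<in> T \<Longrightarrow> u \<noteq> t \<Longrightarrow> c u = 0"
    by (rule singleton_relation[OF T(1) closed cR ct(1,2)], assumption) (rule that)
  have "(\<Sum>t\<in>T. scale (c t) (w t)) = scale (c t) (w t)"
    using T(1) c by (subst sum.remove[of _ t]) auto
  then have "scale (c t) (w t) \<in> U" using c(1) by (simp add: R_def)
  then have "scale (1 / c t) (scale (c t) (w t)) \<in> U" by (rule subspace_scale[OF U(1)])
  moreover have "scale (1 / c t) (scale (c t) (w t)) = w t" using c(3) by simp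
  ultimately show False using wU by metis
qed

text \<open>Modulo \<open>plane y\<close>, which every form in \<open>stab y\<close> annihilates,
  the claim concerns the reduction \<open>A'\<close>: the common orthogonal of the component
  \<open>x1\<close> of \<open>x\<close> under \<open>stab y\<close> must be spanned by the
  components of \<open>plane x\<close>. Counting evaluations over two splitting steps bounds its
  dimension by 2.\<close>

lemma stabilizer_annihilator:
  assumes "x \<noteq> 0" "y \<noteq> 0" "y \<notin> plane x"
    and w: "\<And>d. d \<in> D \<Longrightarrow> (\<And>v. d y v = 0) \<Longrightarrow> d x w = 0"
  obtains p q where "p \<in> plane x" "q \<in> plane y" "w = p + q"
proof -
  obtain s where s: "s \<in> S" using S_nonempty by blast
  interpret nondeg_family scale Basis UNIV s D by (rule nondeg_family[OF s])
  obtain A' where A': "splits y A'" "dim A' + 2 = 2 * n"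
    using splits_exists[of y] assms(2) dim_space by auto
  interpret sub: nondeg_family scale Basis A' s "stab y"
    by (rule splits_nondeg_family[OF A'(1)]) simp
  have A'y: "s y a = 0" "s a y = 0" if "a \<in> A'" for a
    using A'(1) that s0_skew[of a y] by (auto simp: splits_def)
  have yA': "y \<notin> A'" using A'(1) by (simp add: splits_def)
  obtain y' where y': "y' \<in> plane y" "y' \<notin> span {y}" using plane_second[OF assms(2)] by blast
  have syy': "s y y' \<noteq> 0" using plane_isotropic[OF s assms(2)] y' by blast
  have split: "\<exists>p\<in>plane y. \<exists>a\<in>A'. v = p + a" for v
  proof -
    define u where "u = v - scale (s y v / s y y') y'"
    have "s y u = 0" using syy' by (simp add: u_def s0_simps)
    then obtain k where k: "u - scale k y \<in> A'" using A'(1) by (auto simp: splits_def)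
    have "scale k y + scale (s y v / s y y') y' \<in> plane y"
      using y' self_plane subspace_plane by (intro subspace_add subspace_scale)
    moreover have "v = (scale k y + scale (s y v / s y y') y') + (u - scale k y)"
      by (simp add: u_def)
    ultimately show ?thesis using k by blast
  qed
  have stab_y: "d p v = 0" "d v p = 0" if d: "d \<in> stab y" and p: "p \<in> plane y" for d p v
  proof -
    have d': "d \<in> D" "\<And>v. d y v = 0" using d by (auto simp: stab_def)
    show "d p v = 0" by (rule stabilizer_plane[OF assms(2) p d'])
    then show "d v p = 0" using D_skew[OF d'(1), of v p] by simp
  qed
  obtain p1 x1 where x1: "p1 \<in> plane y" "x1 \<in> A'" "x = p1 + x1" using split by metis
  obtain p2 w1 where w1: "p2 \<in> plane y" "w1 \<in> A'" "w = p2 + w1" using split by metis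
  have "x1 \<noteq> 0" using x1 assms(3) plane_sym by auto
  obtain x' where x': "x' \<in> plane x" "x' \<notin> span {x}" using plane_second[OF assms(1)] by blast
  obtain p3 x1' where x1': "p3 \<in> plane y" "x1' \<in> A'" "x' = p3 + x1'" using split by metis

  have partners_y: "partners y \<subseteq> span {y}"
  proof
    fix a assume "a \<in> partners y"
    then obtain e where e: "e \<in> D" "\<And>u v. e u v = wedge (s y) (s a) u v"
      by (auto simp: partners_def)
    then have "e = wedge (s y) (s a)" by (simp add: fun_eq_iff)
    then have "comm y a" using e(1) comm_iff_wedge[OF s] by blast
    then show "a \<in> span {y}" by (rule comm_only_multiples[OF _ assms(2)])
  qed
  have partners_x1: "sub.partners x1 \<subseteq> span {x1}"
  proof
    fix a assume "a \<in> sub.partners x1"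
    then obtain e where a: "a \<in> A'" and e: "e \<in> stab y"
      "\<And>u v. u \<in> A' \<Longrightarrow> v \<in> A' \<Longrightarrow> e u v = wedge (s x1) (s a) u v"
      by (auto simp: sub.partners_def)
    have e_s: "e (u + u') v = e u v + e u' v" "e v (u + u') = e v u + e v u'" for u u' v
      using e(1) by (auto simp: stab_def D_simps)
    \<comment> \<open>The multiple of \<open>y\<close> makes \<open>lift u\<close> orthogonal to
      \<open>plane y\<close> under \<open>s\<close> without changing its pairing with
      \<open>A'\<close>. Thus the rank two form on \<open>A'\<close> extends to one on the whole
      space that agrees with \<open>e\<close>.\<close>
    define lift where "lift = (\<lambda>u. u - scale (s u y' / s y y') y)"
    have lift: "s (lift u) (p + b) = s u b" if u: "u \<in> A'" and p: "p \<in> plane y" and b: "b \<in> A'" for u p b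
    proof -
      obtain k l where "p = scale k y + scale l y'"
        by (rule plane_elem[OF assms(2) y' p])
      then show ?thesis
        using A'y[OF u] A'y[OF b] syy' by (simp add: lift_def s0_simps)
    qed
    have "e u v = wedge (s (lift x1)) (s (lift a)) u v" for u v
    proof -
      obtain p b where u: "p \<in> plane y" "b \<in> A'" "u = p + b" using split by metis
      obtain q c where v: "q \<in> plane y" "c \<in> A'" "v = q + c" using split by metis
      have "e u v = e b c" using stab_y[OF e(1)] u v by (simp add: e_s)
      also have "\<dots> = wedge (s (lift x1)) (s (lift a)) u v"
        using e(2)[OF u(2) v(2)] lift[OF x1(2)] lift[OF a] u v by (simp add: wedge_def)
      finally show ?thesis .
    qed
    then have "e = wedge (s (lift x1)) (s (lift a))" by (simp add: fun_eq_iff)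
    then have "comm (lift x1) (lift a)"
      using e(1) comm_iff_wedge[OF s] stab_subset by blast
    moreover have "lift x1 \<noteq> 0"
    proof
      assume "lift x1 = 0"
      then have eq: "x1 = scale (s x1 y' / s y y') y" by (simp add: lift_def)
      then have "s x1 y' / s y y' \<noteq> 0" using \<open>x1 \<noteq> 0\<close> by auto
      then have "y = scale (1 / (s x1 y' / s y y')) x1" using eq by (metis scale_one scale_scale nonzero_eq_divide_eq)
      then show False using yA' x1(2) sub.A_closed(3) by metis
    qed
    ultimately have "lift a \<in> span {lift x1}" by (rule comm_only_multiples)
    then obtain k where "lift a = scale k (lift x1)" by (auto simp: span_singleton)
    then have eq: "a - scale k x1 = scale (s a y' / s y y' - k * (s x1 y' / s y y')) y" (is "_ = scale ?c y")
      by (simp add: lift_def algebra_simps)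
    have mem: "a - scale k x1 \<in> A'" using a x1(2) sub.A_closed by blast
    have "?c = 0"
    proof (rule ccontr)
      assume "?c \<noteq> 0"
      then have "y = scale (1 / ?c) (a - scale k x1)" unfolding eq by simp
      then show False using yA' mem sub.A_closed(3) by metis
    qed
    then have "a = scale k x1" using eq by (metis scale_zero_left right_minus_eq)
    then show "a \<in> span {x1}" by (auto simp: span_singleton)
  qed
  have "dim (sub.null x1) \<le> 2"
  proof -
    have fin: "dim (partners y) \<le> 1" "dim (sub.partners x1) \<le> 1"
      using dim_mono[OF partners_y] dim_mono[OF partners_x1] assms(2) \<open>x1 \<noteq> 0\<close> by simp_all
    have null_y: "dim (null y) = 2"
      using dim_plane[OF assms(2)] by (simp add: null_def plane_def)
    obtain m where m: "n = m + 2" using n_ge_2 by (metis le_Suc_ex add.commute)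
    obtain A'' where A'': "sub.splits x1 A''" "dim A'' + 2 = dim A'"
      using sub.splits_exists[OF x1(2) \<open>x1 \<noteq> 0\<close>] by blast
    have "determined (sub.stab x1) A'' (m * (m - 1))"
      using sub.splits_nondeg_family[OF A''(1) x1(2)] A''(2) A'(2) large_field m
      by (intro determined_bound[of scale Basis A'' s]) auto
    from sub.determined_step[OF A''(1) x1(2) this]
    have "determined D UNIV (m * (m - 1) + (dim A' - dim (sub.null x1)) +
        (dim (sub.partners x1) - 1) + (dim UNIV - dim (null y)) + (dim (partners y) - 1))"
      by (rule determined_step[OF A'(1) UNIV_I])
    then have "n * (n - 1) \<le> m * (m - 1) + (dim A' - dim (sub.null x1)) +
        (dim (sub.partners x1) - 1) + (dim UNIV - dim (null y)) + (dim (partners y) - 1)"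
      by (rule D_optimal)
    then have "n * (n - 1) \<le> m * (m - 1) + (2 * n - 2 - dim (sub.null x1)) + (2 * n - 2)"
      using fin null_y dim_space A'(2) by simp
    \<comment> \<open>With \<open>n = m + 2\<close>, both splitting steps together may save nothing
      over the bound; equality in the count is reached at dimension 2.\<close>
    moreover have "n * (n - 1) = m * (m - 1) + 4 * m + 2"
      unfolding m by (cases m) (auto simp: algebra_simps)
    moreover have "dim (sub.null x1) \<le> 2 * n - 2"
      using dim_subset[of "sub.null x1" A'] A'(2) by (auto simp: sub.null_def)
    ultimately show ?thesis using m by linarith
  qed
  moreover have in_null: "u1 \<in> sub.null x1"
    if u: "u = p + u1" "p \<in> plane y" "u1 \<in> A'" "\<And>d. d \<in> stab y \<Longrightarrow> d x u = 0" for u p u1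
  proof -
    have "d x1 u1 = 0" if d: "d \<in> stab y" for d
    proof -
      have "d \<in> D" using d stab_subset by blast
      then have "d x u = d x1 u1"
        using stab_y[OF d] x1 u(1,2) by (simp add: D_simps)
      then show ?thesis using u(4)[OF d] by simp
    qed
    then show ?thesis using u(3) by (simp add: sub.null_def)
  qed
  have "x1' \<in> sub.null x1"
    using in_null[OF x1'(3,1,2)] planeD[OF x'(1)] stab_subset by blast
  have "w1 \<in> sub.null x1"
    using in_null[OF w1(3,1,2)] w by (auto simp: stab_def)
  have "x1' \<notin> span {x1}"
  proof
    assume "x1' \<in> span {x1}"
    then obtain k where k: "x1' = scale k x1" by (auto simp: span_singleton)
    have "x' - scale k x = p3 - scale k p1" using x1 x1' k by (simp add: algebra_simps)
    also have "\<dots> \<in> plane y" using x1 x1' subspace_plane by (intro subspace_diff subspace_scale)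
    finally have "x' - scale k x = 0"
      using planes_meet[OF assms(1-3)] x' self_plane subspace_plane subspace_diff subspace_scale by blast
    then show False using x'(2) by (auto simp: span_singleton)
  qed
  then have dim2: "dim (span {x1, x1'}) = 2"
    by (rule dim_span_pair[OF \<open>x1 \<noteq> 0\<close>])
  have "x1 \<in> sub.null x1" using x1(2) by (auto simp: sub.null_def sub.D_simps)
  then have "span {x1, x1'} \<subseteq> sub.null x1"
    using \<open>x1' \<in> sub.null x1\<close> sub.subspace_null by (intro span_minimal) auto
  then have "span {x1, x1'} = sub.null x1"
    using subspace_dim_equal[OF subspace_span sub.subspace_null] dim2 \<open>dim (sub.null x1) \<le> 2\<close> by simp
  then have "w1 \<in> span (insert x1 {x1'})" using \<open>w1 \<in> sub.null x1\<close> by simp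
  then obtain k l where "w1 - scale k x1 = scale l x1'"
    unfolding span_breakdown_eq span_singleton by blast
  then have wkl: "w1 = scale k x1 + scale l x1'" by (simp add: algebra_simps)
  show ?thesis
  proof (rule that)
    show "scale k x + scale l x' \<in> plane x"
      using x'(1) self_plane subspace_plane by (intro subspace_add subspace_scale)
    show "p2 - scale k p1 - scale l p3 \<in> plane y"
      using x1 w1 x1' subspace_plane by (intro subspace_diff subspace_scale)
    show "w = (scale k x + scale l x') + (p2 - scale k p1 - scale l p3)"
      using w1 x1 x1' wkl by (simp add: algebra_simps)
  qed
qed

section \<open>Gluing an endomorphism that preserves the planes\<close>

lemma plane_add:
  assumes "x \<noteq> 0" "y \<noteq> 0" "y \<notin> plane x" "w \<in> plane (x + y)"
  obtains p q where "p \<in> plane x" "q \<in> plane y" "w = p + q"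
proof (rule stabilizer_annihilator[OF assms(1-3)])
  \<comment> \<open>A form that annihilates \<open>y\<close> has the same values at \<open>x\<close>
    as at \<open>x + y\<close>.\<close>
  show "d x w = 0" if "d \<in> D" "\<And>v. d y v = 0" for d
    using planeD[OF assms(4) that(1)] that by (simp add: D_simps)
qed (rule that)

text \<open>Vectors are read as functionals on \<open>D\<close>: \<open>d \<mapsto> d x' z\<close>
  vanishes wherever all \<open>d \<mapsto> d x b\<close> with \<open>b\<close> in the basis vanish,
  so it is a combination of these, and the coefficients assemble \<open>w\<close>.\<close>

lemma pairing_solution:
  assumes "\<And>d. d \<in> D \<Longrightarrow> (\<And>v. d x v = 0) \<Longrightarrow> d x' z = 0"
  obtains w where "\<And>d. d \<in> D \<Longrightarrow> d x' z = d x w"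
proof -
  have "\<exists>c. \<forall>d\<in>D. d x' z = (\<Sum>b\<in>Basis. c b * d x b)"
  proof (rule forms.functional_in_span_of_finite[OF finite_Basis _ _ subspace_D])
    show "Vector_Spaces.linear form_scale (*) (\<lambda>d. d x b)" for b
      using vector_space_form_scale by (rule functionalI) auto
    show "Vector_Spaces.linear form_scale (*) (\<lambda>d. d x' z)"
      using vector_space_form_scale by (rule functionalI) auto
    fix d assume d: "d \<in> D" "\<forall>b\<in>Basis. d x b = 0"
    have "subspace {v. d x v = 0}" using d(1) by (intro subspaceI) (auto simp: D_simps)
    then have "span Basis \<subseteq> {v. d x v = 0}" using d(2) by (intro span_minimal) auto
    then have "d x v = 0" for v using span_Basis by blast
    then show "d x' z = 0" using assms d(1) by blast
  qed
  then obtain c where "\<forall>d\<in>D. d x' z = (\<Sum>b\<in>Basis. c b * d x b)" by blast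
  then have "d x' z = d x (\<Sum>b\<in>Basis. scale (c b) b)" if "d \<in> D" for d
    using that by (simp add: D_simps)
  then show ?thesis by (rule that)
qed

text \<open>The vector \<open>a z\<close> is the unique \<open>w\<close> with
  \<open>d x' z = d x w\<close> and \<open>d y' z = d y w\<close> for all \<open>d\<close> in
  \<open>D\<close>. The choice of \<open>x'\<close> and \<open>y'\<close> with
  \<open>x' + y'\<close> in \<open>plane (x + y)\<close> makes both equations solvable at once and
  gives \<open>a x = x'\<close> and \<open>a y = y'\<close>.\<close>

lemma quadratic_endomorphism:
  obtains a \<alpha> \<beta> where "Vector_Spaces.linear scale scale a"
    "\<And>d z. d \<in> D \<Longrightarrow> d z (a z) = 0" "\<And>z k. a z = scale k z \<Longrightarrow> z = 0"
    "\<And>z. a (a z) = scale \<alpha> z + scale \<beta> (a z)"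
proof -
  have "dim {0 :: 'v} < dim (UNIV :: 'v set)" using dim_space n_ge_2 by simp
  then obtain x :: 'v where x: "x \<noteq> 0" by (metis UNIV_eq_I singletonI less_irrefl)
  have "plane x \<noteq> UNIV" using dim_plane[OF x] dim_space n_ge_2 by auto
  then obtain y where y: "y \<notin> plane x" by blast
  have y0: "y \<noteq> 0" using y subspace_0[OF subspace_plane] by auto
  have xy: "x \<notin> plane y" using y plane_sym by blast
  have sum0: "x + y \<noteq> 0"
  proof
    assume "x + y = 0"
    then have "y = - x" by (simp add: eq_neg_iff_add_eq_0 add.commute)
    then show False using y subspace_neg[OF subspace_plane self_plane] by simp
  qed
  have sum_plane: "plane (x + y) \<noteq> plane x" "plane (x + y) \<noteq> plane y"
  proof -
    show "plane (x + y) \<noteq> plane x"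
    proof
      assume "plane (x + y) = plane x"
      then have "x + y - x \<in> plane x"
        using self_plane subspace_diff[OF subspace_plane] by blast
      then show False using y by simp
    qed
    show "plane (x + y) \<noteq> plane y"
    proof
      assume "plane (x + y) = plane y"
      then have "x + y - y \<in> plane y"
        using self_plane subspace_diff[OF subspace_plane] by blast
      then show False using xy by simp
    qed
  qed
  obtain x' where x': "x' \<in> plane x" "x' \<notin> span {x}" using plane_second[OF x] by blast
  obtain w where w: "w \<in> plane (x + y)" "w \<notin> span {x + y}" using plane_second[OF sum0] by blast
  obtain p q where pq: "p \<in> plane x" "q \<in> plane y" "w = p + q"
    by (rule plane_add[OF x y0 y w(1)])
  obtain k l where p: "p = scale k x + scale l x'" by (rule plane_elem[OF x x' pq(1)])
  have mem: "scale l x' + (q - scale k y) \<in> plane (x + y)" (is "?r \<in> _")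
  proof -
    have "?r = w - scale k (x + y)" using pq(3) p by (simp add: algebra_simps)
    then show ?thesis
      using w(1) subspace_diff subspace_scale subspace_plane self_plane by simp
  qed
  have r0: "?r \<noteq> 0"
  proof
    assume "?r = 0"
    then have "w = scale k (x + y)" using pq(3) p by (simp add: algebra_simps)
    then show False using w(2) by (auto simp: span_singleton)
  qed
  have qk: "q - scale k y \<in> plane y"
    using pq(2) self_plane subspace_plane by (intro subspace_diff subspace_scale)
  have "l \<noteq> 0"
  proof
    assume "l = 0"
    then have "?r \<in> plane y" using qk by simp
    then show False using plane_eq[OF mem sum0 r0] plane_eq[of ?r y] y0 r0 sum_plane by simp
  qed
  \<comment> \<open>Subtracting \<open>k (x + y)\<close> from \<open>w\<close> and dividing by
    \<open>l\<close> normalises its component in \<open>plane x\<close> to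
    \<open>x'\<close>.\<close>
  define y' where "y' = scale (1 / l) (q - scale k y)"
  have y': "y' \<in> plane y" unfolding y'_def using qk by (rule subspace_scale[OF subspace_plane])
  have "x' + y' = scale (1 / l) ?r" using \<open>l \<noteq> 0\<close> by (simp add: y'_def scale_right_distrib)
  then have sum': "x' + y' \<in> plane (x + y)" using mem subspace_scale[OF subspace_plane] by metis
  have "y' \<notin> span {y}"
  proof
    assume "y' \<in> span {y}"
    then obtain c where c: "y' = scale c y" by (auto simp: span_singleton)
    have "x' + y' - scale c (x + y) \<in> plane (x + y)"
      using sum' self_plane subspace_plane by (intro subspace_diff subspace_scale)
    then have "x' - scale c x \<in> plane (x + y)" using c by (simp add: algebra_simps)
    moreover have "x' - scale c x \<in> plane x"
      using x'(1) self_plane subspace_plane by (intro subspace_diff subspace_scale)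
    moreover have "x' - scale c x \<noteq> 0" using x'(2) by (auto simp: span_singleton)
    ultimately show False using plane_eq sum0 x sum_plane by metis
  qed
  note y' = y' this

  have cross: "d x y' = d x' y" if d: "d \<in> D" for d
  proof -
    have "d x y' + d y x' = 0"
      using planeD[OF sum' d] planeD[OF x'(1) d] planeD[OF y'(1) d] by (simp add: D_simps[OF d] add.commute)
    then show ?thesis using D_skew[OF d, of x' y] by (simp add: add_eq_0_iff2)
  qed

  have unique: "w = w'" if "\<And>d. d \<in> D \<Longrightarrow> d x w = d x w'" "\<And>d. d \<in> D \<Longrightarrow> d y w = d y w'" for w w'
  proof -
    have "w - w' = 0"
      using that by (intro planes_meet[OF x y0 y]) (auto simp: plane_def D_simps)
    then show ?thesis by simp
  qed
  \<comment> \<open>The separate solutions for \<open>x\<close>, \<open>y\<close> and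
    \<open>x + y\<close> differ by elements of \<open>plane x + plane y\<close>; moving these parts
    between \<open>w1\<close> and \<open>w2\<close> makes them agree.\<close>
  have "\<exists>w. \<forall>d\<in>D. d x' z = d x w \<and> d y' z = d y w" for z
  proof -
    have st: "d x' v = 0" if "d \<in> D" "\<And>v. d x v = 0" for d v
      by (rule stabilizer_plane[OF x x'(1) that])
    have st': "d y' v = 0" if "d \<in> D" "\<And>v. d y v = 0" for d v
      by (rule stabilizer_plane[OF y0 y'(1) that])
    have st'': "d (x' + y') v = 0" if "d \<in> D" "\<And>v. d (x + y) v = 0" for d v
      by (rule stabilizer_plane[OF sum0 sum' that])
    obtain w1 where w1: "\<And>d. d \<in> D \<Longrightarrow> d x' z = d x w1" using pairing_solution[of x x' z] st by metis
    obtain w2 where w2: "\<And>d. d \<in> D \<Longrightarrow> d y' z = d y w2" using pairing_solution[of y y' z] st' by metis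
    obtain w3 where w3: "\<And>d. d \<in> D \<Longrightarrow> d (x' + y') z = d (x + y) w3"
      using pairing_solution[of "x + y" "x' + y'" z] st'' by metis
    have "d x (w1 - w3) = 0" if d: "d \<in> D" "\<And>v. d y v = 0" for d
      using w1[OF d(1)] w3[OF d(1)] st'[OF d] d(2) by (simp add: D_simps[OF d(1)])
    then obtain p q where pq: "p \<in> plane x" "q \<in> plane y" "w1 - w3 = p + q"
      using stabilizer_annihilator[OF x y0 y, of "w1 - w3"] by metis
    have "d y (w2 - w3) = 0" if d: "d \<in> D" "\<And>v. d x v = 0" for d
      using w2[OF d(1)] w3[OF d(1)] st[OF d] d(2) by (simp add: D_simps[OF d(1)])
    then obtain q' p' where pq': "q' \<in> plane y" "p' \<in> plane x" "w2 - w3 = q' + p'"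
      using stabilizer_annihilator[OF y0 x xy, of "w2 - w3"] by metis
    have eq: "w1 - (p - p') = w2 - (q' - q)" using pq(3) pq'(3) by (simp add: algebra_simps)
    have mem: "p - p' \<in> plane x" "q' - q \<in> plane y"
      using pq pq' subspace_plane by (auto intro: subspace_diff)
    have "d x' z = d x (w1 - (p - p'))" "d y' z = d y (w2 - (q' - q))" if d: "d \<in> D" for d
      using planeD[OF mem(1) d] planeD[OF mem(2) d] w1[OF d] w2[OF d]
        D_simps(10)[OF d, of x w1 "p - p'"] D_simps(10)[OF d, of y w2 "q' - q"] by (simp_all only: diff_zero)
    then show ?thesis unfolding eq by blast
  qed
  then obtain a where "\<And>z. \<forall>d\<in>D. d x' z = d x (a z) \<and> d y' z = d y (a z)" by metis
  then have a: "d x' z = d x (a z)" "d y' z = d y (a z)" if "d \<in> D" for d z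
    using that by blast+
  have a_eq: "a z = w"
    if "\<And>d. d \<in> D \<Longrightarrow> d x' z = d x w" "\<And>d. d \<in> D \<Longrightarrow> d y' z = d y w" for z w
  proof (rule unique)
    fix d assume "d \<in> D"
    then show "d x (a z) = d x w" "d y (a z) = d y w" using a[of d z] that[of d] by simp_all
  qed
  have add: "a (u + v) = a u + a v" for u v
    by (rule a_eq) (simp_all add: D_simps a)
  have mult: "a (scale c u) = scale c (a u)" for c u
    by (rule a_eq) (simp_all add: D_simps a)
  have ax: "a x = x'"
  proof (rule a_eq)
    fix d assume d: "d \<in> D"
    show "d x' x = d x x'" using planeD[OF x'(1) d] D_skew[OF d, of x' x] by simp
    show "d y' x = d y x'"
      using D_skew[OF d, of y' x] D_skew[OF d, of y x'] cross[OF d] by simp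
  qed
  have ay: "a y = y'"
  proof (rule a_eq)
    fix d assume d: "d \<in> D"
    show "d x' y = d x y'" using cross[OF d] by simp
    show "d y' y = d y y'" using planeD[OF y'(1) d] D_skew[OF d, of y' y] by simp
  qed
  have "d x (a x') = 0" if "d \<in> D" for d using a(1)[OF that, of x'] by (simp add: D_simps[OF that])
  then have "a x' \<in> plane x" by (simp add: plane_def)
  then obtain \<alpha> \<beta> where ax': "a x' = scale \<alpha> x + scale \<beta> x'" by (rule plane_elem[OF x x'])
  have val: "d x' y' = \<alpha> * d x y + \<beta> * d x' y" if d: "d \<in> D" for d
  proof -
    have "d x' y' = - d y (a x')" using a(2)[OF d, of x'] D_skew[OF d, of x' y'] by simp
    also have "\<dots> = \<alpha> * d x y + \<beta> * d x' y"
      using D_skew[OF d, of y x] D_skew[OF d, of y x'] by (simp add: ax' D_simps[OF d])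
    finally show ?thesis .
  qed
  have ay': "a y' = scale \<alpha> y + scale \<beta> y'"
  proof (rule a_eq)
    fix d assume d: "d \<in> D"
    show "d x' y' = d x (scale \<alpha> y + scale \<beta> y')"
      unfolding val[OF d] D_simps[OF d] cross[OF d] by (rule refl)
    show "d y' y' = d y (scale \<alpha> y + scale \<beta> y')"
      using planeD[OF y'(1) d] by (simp add: D_simps[OF d])
  qed

  have iso: "d z (a z) = 0" if d: "d \<in> D" for d z
  proof (cases "\<exists>p\<in>plane x. \<exists>q\<in>plane y. z = p + q")
    case True
    then obtain p q where pq: "p \<in> plane x" "q \<in> plane y" "z = p + q" by blast
    obtain k1 k2 where p: "p = scale k1 x + scale k2 x'" by (rule plane_elem[OF x x' pq(1)])
    obtain k3 k4 where q: "q = scale k3 y + scale k4 y'" by (rule plane_elem[OF y0 y' pq(2)])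
    have az: "a z = scale k1 x' + scale k2 (scale \<alpha> x + scale \<beta> x')
        + (scale k3 y' + scale k4 (scale \<alpha> y + scale \<beta> y'))"
      by (simp add: pq(3) p q add mult ax ay ax' ay')
    have zero: "d x x' = 0" "d x' x = 0" "d y y' = 0" "d y' y = 0"
      using planeD[OF x'(1) d] planeD[OF y'(1) d] D_skew[OF d, of x' x] D_skew[OF d, of y' y] by simp_all
    have rev: "d y x = - d x y" "d y x' = - d x' y" "d y' x = - d x' y"
      "d y' x' = - (\<alpha> * d x y + \<beta> * d x' y)"
      using D_skew[OF d, of y x] D_skew[OF d, of y x'] D_skew[OF d, of y' x] D_skew[OF d, of y' x']
        cross[OF d] val[OF d] by simp_all
    show ?thesis
      unfolding az unfolding pq(3) p q
      by (simp only: D_simps[OF d] zero rev cross[OF d] val[OF d]) (simp add: algebra_simps)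
  next
    case False
    note outside = False
    have z0: "z \<noteq> 0"
      using False subspace_0[OF subspace_plane[of x]] subspace_0[OF subspace_plane[of y]] by force
    have zx: "z \<notin> plane x" using False subspace_0[OF subspace_plane[of y]] by force
    have zy: "z \<notin> plane y" using False subspace_0[OF subspace_plane[of x]] by force
    \<comment> \<open>So \<open>a z\<close> lies in \<open>plane x + plane z\<close>, and likewise
      in \<open>plane y + plane z\<close>. Were the components \<open>p\<close> and \<open>q\<close>
      different, \<open>z\<close> would lie in the plane of \<open>p - q\<close>, hence in
      \<open>plane x + plane y\<close>.\<close>
    have "e x (a z) = 0" if e: "e \<in> D" "\<And>v. e z v = 0" for e
      using a(1)[OF e(1), of z] D_skew[OF e(1), of x' z] e(2) by simp
    then obtain p r where pr: "p \<in> plane x" "r \<in> plane z" "a z = p + r"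
      using stabilizer_annihilator[OF x z0 zx, of "a z"] by metis
    have "e y (a z) = 0" if e: "e \<in> D" "\<And>v. e z v = 0" for e
      using a(2)[OF e(1), of z] D_skew[OF e(1), of y' z] e(2) by simp
    then obtain q r' where qr: "q \<in> plane y" "r' \<in> plane z" "a z = q + r'"
      using stabilizer_annihilator[OF y0 z0 zy, of "a z"] by metis
    have "p - q = r' - r" using pr(3) qr(3) by (simp add: algebra_simps)
    also have "\<dots> \<in> plane z" using pr qr subspace_plane by (intro subspace_diff)
    finally have pq: "p - q \<in> plane z" .
    have "p = q"
    proof (rule ccontr)
      assume "p \<noteq> q"
      then have eq: "plane (p - q) = plane z" using plane_eq[OF pq z0] by simp
      show False
      proof (cases "p = 0 \<or> q = 0")
        case True
        then show ?thesis
        proof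
          assume "p = 0"
          then have "p - q \<in> plane y" "p - q \<noteq> 0"
            using qr(1) \<open>p \<noteq> q\<close> subspace_neg[OF subspace_plane] by auto
          then show False using plane_eq[of "p - q" y] y0 eq self_plane zy by blast
        next
          assume "q = 0"
          then have "p - q \<in> plane x" "p - q \<noteq> 0" using pr(1) \<open>p \<noteq> q\<close> by auto
          then show False using plane_eq[of "p - q" x] x eq self_plane zx by blast
        qed
      next
        case False
        have px: "plane p = plane x" using plane_eq[OF pr(1) x] False by simp
        have "- q \<in> plane y" using qr(1) by (rule subspace_neg[OF subspace_plane])
        then have qy: "plane (- q) = plane y" using plane_eq[of "- q" y] y0 False by simp
        have "- q \<notin> plane p"
        proof
          assume "- q \<in> plane p"
          then have "plane (- q) = plane p" using plane_eq[of "- q" p] False by simp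
          then show False using px qy y self_plane by metis
        qed
        moreover have "z \<in> plane (p + - q)" using eq self_plane by simp
        ultimately obtain u v where "u \<in> plane p" "v \<in> plane (- q)" "z = u + v"
          using plane_add[of p "- q" z] False by (metis neg_equal_0_iff_equal)
        then show False using outside px qy by blast
      qed
    qed
    then have "p = 0" using planes_meet[OF x y0 y pr(1)] qr(1) by simp
    then show ?thesis using planeD[OF pr(2) d] pr(3) by simp
  qed

  \<comment> \<open>Polarising \<open>iso\<close>: the endomorphism is self-adjoint for every form
    in \<open>D\<close>.\<close>
  have polar: "d u (a v) = d (a u) v" if d: "d \<in> D" for d u v
    using iso[OF d, of "u + v"] iso[OF d, of u] iso[OF d, of v] D_skew[OF d, of v "a u"]
    by (simp add: add D_simps[OF d])

  show ?thesis
  proof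
    show "Vector_Spaces.linear scale scale a"
      unfolding Vector_Spaces.linear_iff using vector_space_axioms by (simp add: add mult)
    show "d z (a z) = 0" if "d \<in> D" for d z by (rule iso[OF that])
    \<comment> \<open>An eigenvector with eigenvalue \<open>k\<close> lies in the planes of
      \<open>x' - k x\<close> and \<open>y' - k y\<close>, which are those of \<open>x\<close> and
      \<open>y\<close>.\<close>
    show "z = 0" if k: "a z = scale k z" for z k
    proof (rule planes_meet[OF x y0 y])
      have "d (x' - scale k x) z = 0" "d (y' - scale k y) z = 0" if d: "d \<in> D" for d
        using a[OF d, of z] by (simp_all add: k D_simps[OF d])
      then have zz: "z \<in> plane (x' - scale k x)" "z \<in> plane (y' - scale k y)" by (simp_all add: plane_def)
      have "x' - scale k x \<in> plane x" "y' - scale k y \<in> plane y"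
        using x'(1) y'(1) self_plane subspace_plane by (auto intro!: subspace_diff subspace_scale)
      moreover have "x' - scale k x \<noteq> 0" "y' - scale k y \<noteq> 0"
        using x'(2) y'(2) by (auto simp: span_singleton)
      ultimately show "z \<in> plane x" "z \<in> plane y" using zz plane_eq x y0 by metis+
    qed
    show "a (a z) = scale \<alpha> z + scale \<beta> (a z)" for z
    proof (rule a_eq)
      fix d assume d: "d \<in> D"
      show "d x' (a z) = d x (scale \<alpha> z + scale \<beta> (a z))"
        using polar[OF d, of x' z] a(1)[OF d, of z] by (simp add: ax' D_simps[OF d])
      show "d y' (a z) = d y (scale \<alpha> z + scale \<beta> (a z))"
        using polar[OF d, of y' z] a(2)[OF d, of z] by (simp add: ay' D_simps[OF d])
    qed
  qed
qed

end

section \<open>The quadratic extension\<close>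

text \<open>The quadratic relation closes the span of \<open>id\<close> and \<open>a\<close> under
  composition, and the absence of eigenvectors makes this span two-dimensional and every nonzero
  element injective.\<close>

lemma quadratic_extension_generated:
  fixes scale :: "'f::field \<Rightarrow> 'v::ab_group_add \<Rightarrow> 'v"
  assumes "vector_space scale" and a: "Vector_Spaces.linear scale scale a"
    and no_eigen: "\<And>z k. a z = scale k z \<Longrightarrow> z = 0"
    and quad: "\<And>z. a (a z) = scale \<alpha> z + scale \<beta> (a z)"
    and nontrivial: "v \<noteq> (0 :: 'v)"
  shows "generated_algebra scale a = {(\<lambda>z. scale p z + scale q (a z)) | p q. True}"
    and "quadratic_extension scale (generated_algebra scale a)"
proof -
  interpret vector_space scale by fact
  interpret E: vector_space "end_scale scale" by (rule vector_space_end_scale) fact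
  interpret a: module_hom scale scale a using a by (simp add: linear_iff_module_hom)
  note a_simps = a.add a.scale a.neg a.diff
  define L where "L = {(\<lambda>z. scale p z + scale q (a z)) | p q. True}"
  have L_I: "f \<in> L" if "\<And>z. f z = scale p z + scale q (a z)" for f p q
    unfolding L_def using that by (intro CollectI exI[of _ p] exI[of _ q]) (simp add: fun_eq_iff)
  have idL: "id \<in> L" by (rule L_I[of _ 1 0]) simp
  have aL: "a \<in> L" by (rule L_I[of _ 0 1]) simp
  have subL: "E.subspace L"
  proof (rule E.subspaceI)
    show "0 \<in> L" by (rule L_I[of _ 0 0]) simp
  next
    fix f g assume "f \<in> L" "g \<in> L"
    then obtain p q p' q' where "f = (\<lambda>z. scale p z + scale q (a z))" "g = (\<lambda>z. scale p' z + scale q' (a z))"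
      by (auto simp: L_def)
    then show "f + g \<in> L" by (intro L_I[of _ "p + p'" "q + q'"]) (simp add: algebra_simps)
  next
    fix c f assume "f \<in> L"
    then obtain p q where "f = (\<lambda>z. scale p z + scale q (a z))" by (auto simp: L_def)
    then show "end_scale scale c f \<in> L"
      by (intro L_I[of _ "c * p" "c * q"]) (simp add: end_scale_def algebra_simps)
  qed
  have L_span: "L = E.span {id, a}"
  proof
    show "L \<subseteq> E.span {id, a}"
    proof
      fix f assume "f \<in> L"
      then obtain p q where "f = (\<lambda>z. scale p z + scale q (a z))" by (auto simp: L_def)
      then have "f = end_scale scale p id + end_scale scale q a" by (simp add: fun_eq_iff end_scale_def)
      then show "f \<in> E.span {id, a}" by (auto intro!: E.span_add E.span_scale intro: E.span_base)
    qed
    show "E.span {id, a} \<subseteq> L" using idL aL subL by (intro E.span_minimal) auto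
  qed
  have comp: "(\<lambda>z. scale p z + scale q (a z)) \<circ> (\<lambda>z. scale p' z + scale q' (a z))
      = (\<lambda>z. scale (p * p' + q * q' * \<alpha>) z + scale (p * q' + q * p' + q * q' * \<beta>) (a z))" for p q p' q'
    by (simp add: fun_eq_iff a_simps quad algebra_simps)
  have compL: "f \<circ> g \<in> L" if "f \<in> L" "g \<in> L" for f g
    using that comp unfolding L_def by blast
  have "a ^^ k \<in> L" for k
  proof (induction k)
    case 0
    then show ?case using idL by (simp only: funpow.simps)
  next
    case (Suc k)
    then show ?case using compL[OF aL] by (simp only: funpow.simps)
  qed
  then have "range (\<lambda>k. a ^^ k) \<subseteq> L" by blast
  then have "E.span (range (\<lambda>k. a ^^ k)) \<subseteq> L" using subL by (rule E.span_minimal)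
  moreover have "{id, a} \<subseteq> range (\<lambda>k. a ^^ k)"
    using rangeI[of "\<lambda>k. a ^^ k" 0] rangeI[of "\<lambda>k. a ^^ k" 1] by simp
  then have "L \<subseteq> E.span (range (\<lambda>k. a ^^ k))" unfolding L_span by (rule E.span_mono)
  ultimately have gen: "generated_algebra scale a = L" unfolding generated_algebra_def by blast
  then show "generated_algebra scale a = {(\<lambda>z. scale p z + scale q (a z)) | p q. True}"
    by (simp only: L_def)

  have ne: "id \<noteq> (0 :: 'v \<Rightarrow> 'v)"
  proof
    assume "id = (0 :: 'v \<Rightarrow> 'v)"
    then have "id v = (0 :: 'v \<Rightarrow> 'v) v" by simp
    then show False using nontrivial by simp
  qed
  have "a \<notin> E.span {id}"
  proof
    assume "a \<in> E.span {id}"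
    then obtain k where "a = end_scale scale k id" by (auto simp: E.span_singleton)
    then have "a v = scale k v" by (simp add: end_scale_def)
    then show False using no_eigen nontrivial by blast
  qed
  then have "E.independent {a, id}" using ne by (intro E.independent_insertI E.independent_empty) auto
  moreover have "a \<noteq> id" using \<open>a \<notin> E.span {id}\<close> E.span_base by blast
  ultimately have dimL: "E.dim L = 2"
    unfolding L_span using E.dim_span_eq_card_independent[of "{a, id}"] by (simp add: insert_commute)

  have inverse: "\<exists>g\<in>L. f \<circ> g = id \<and> g \<circ> f = id" if f: "f \<in> L" "f \<noteq> 0" for f
  proof -
    obtain p q where pq: "f = (\<lambda>z. scale p z + scale q (a z))" using f by (auto simp: L_def)
    define N where "N = p * p + p * q * \<beta> - q * q * \<alpha>"
    have f_inj: "z = 0" if z: "f z = 0" for z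
    proof (cases "q = 0")
      case True
      then have "p \<noteq> 0" using f(2) pq by (auto simp: fun_eq_iff)
      then show ?thesis using z pq True by simp
    next
      case False
      have "scale q (a z) = - scale p z" using z pq by (simp add: eq_neg_iff_add_eq_0 add.commute)
      then have "scale (1 / q) (scale q (a z)) = scale (1 / q) (- scale p z)" by simp
      then have "a z = scale (- p / q) z" using False by simp
      then show ?thesis by (rule no_eigen)
    qed
    \<comment> \<open>The conjugate of \<open>f = p + q a\<close>; the product of the two is the
      norm \<open>N\<close>, so \<open>g / N\<close> is the inverse.\<close>
    define g where "g = (\<lambda>z. scale (p + q * \<beta>) z + scale (- q) (a z))"
    have fg: "f \<circ> g = (\<lambda>z. scale N z)" "g \<circ> f = (\<lambda>z. scale N z)"
      unfolding pq g_def comp by (simp_all add: N_def algebra_simps)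
    have "N \<noteq> 0"
    proof
      assume "N = 0"
      then have "f (g v) = 0" using fg(1) by (simp add: fun_eq_iff)
      then have "g v = 0" by (rule f_inj)
      then have gv: "scale (p + q * \<beta>) v = scale q (a v)" by (simp add: g_def)
      have "q = 0"
      proof (rule ccontr)
        assume "q \<noteq> 0"
        then have "a v = scale ((p + q * \<beta>) / q) v"
          using arg_cong[OF gv, of "scale (1 / q)"] by simp
        then show False using no_eigen nontrivial by blast
      qed
      then have "p = 0" using gv nontrivial by simp
      then show False using \<open>q = 0\<close> pq f(2) by (simp add: fun_eq_iff)
    qed
    define h where "h = (\<lambda>z. scale ((p + q * \<beta>) / N) z + scale (- q / N) (a z))"
    have "f \<circ> h = id" "h \<circ> f = id"
    proof -
      have 1: "h z = scale (1 / N) (g z)" for z by (simp add: h_def g_def scale_right_diff_distrib)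
      have 2: "f (scale c z) = scale c (f z)" for c z by (simp add: pq a_simps algebra_simps)
      show "f \<circ> h = id" "h \<circ> f = id"
        using fg \<open>N \<noteq> 0\<close> by (simp_all add: fun_eq_iff 1 2)
    qed
    moreover have "h \<in> L" by (rule L_I[of h "(p + q * \<beta>) / N" "- q / N"]) (simp add: h_def)
    ultimately show ?thesis by blast
  qed
  have "Vector_Spaces.linear scale scale f" if f: "f \<in> L" for f
  proof -
    obtain p q where "f = (\<lambda>z. scale p z + scale q (a z))" using f by (auto simp: L_def)
    then show ?thesis
      unfolding Vector_Spaces.linear_iff using assms(1) by (simp add: a_simps algebra_simps)
  qed
  then have "end_subalgebra scale L"
    unfolding end_subalgebra_def endomorphisms_def using subL idL compL by blast
  moreover have "f \<circ> g = g \<circ> f" if fg: "f \<in> L" "g \<in> L" for f g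
  proof -
    obtain p q p' q' where "f = (\<lambda>z. scale p z + scale q (a z))" "g = (\<lambda>z. scale p' z + scale q' (a z))"
      using fg by (auto simp: L_def)
    then show ?thesis by (simp add: comp mult_ac add_ac)
  qed
  ultimately show "quadratic_extension scale (generated_algebra scale a)"
    unfolding gen quadratic_extension_def using inverse ne dimL by blast
qed

section \<open>From the hypotheses on the affine space to the theorem\<close>

lemma irreducible_optimal_familyI:
  fixes scale :: "'f::field \<Rightarrow> 'v::ab_group_add \<Rightarrow> 'v"
  assumes "finite_dimensional_vector_space scale Basis"
    and "vector_space.dim scale (UNIV :: 'v set) = 2 * n" "n \<ge> 2"
    and "infinite (UNIV :: 'f set) \<or> card (UNIV :: 'f set) > 2 * n - 2"
    and opt: "optimal_symplectic_affine_subspace scale S"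
    and irr: "irreducible_forms scale S"
  obtains D where "irreducible_optimal_family scale Basis n S D"
    "n * (n - 1) \<le> forms.dim D"
proof -
  interpret finite_dimensional_vector_space scale Basis by fact
  obtain s1 D where s1: "s1 \<in> alternating_forms scale" and D: "D \<subseteq> alternating_forms scale"
    "forms.subspace D" "S = (\<lambda>d. s1 + d) ` D"
    using opt unfolding optimal_symplectic_affine_subspace_def symplectic_affine_subspace_def
      affine_subspace_alt_def by blast
  note sub = subspace_alternating_forms[OF vector_space_axioms]
  have dimS: "affine_dimension S = forms.dim D"
    unfolding D(3) by (rule affine_dimension_translate[OF D(2)])
  have translate: "S = (\<lambda>d. s + d) ` D" if s: "s \<in> S" for s
  proof -
    obtain e where e: "e \<in> D" "s = s1 + e" using s D(3) by blast
    have "s1 + d = s + (d - e)" "s + d = s1 + (e + d)" for d using e(2) by (simp_all add: algebra_simps)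
    then show ?thesis
      unfolding D(3) using forms.subspace_diff[OF D(2) _ e(1)] forms.subspace_add[OF D(2) e(1)]
      by (intro equalityI subsetI; elim imageE) (metis imageI)+
  qed
  have nd: "nondegenerate s" if "s \<in> S" for s
    using opt that by (simp add: optimal_symplectic_affine_subspace_def symplectic_affine_subspace_def)
  obtain T where T: "symplectic_affine_subspace scale T" "affine_dimension T = n * (n - 1)"
    using antitriangular_symplectic_space assms(2) by metis
  then have dimD: "n * (n - 1) \<le> forms.dim D"
    using opt unfolding optimal_symplectic_affine_subspace_def dimS by metis
  \<comment> \<open>The antitriangular example bounds \<open>forms.dim D\<close> from below, and
    determining evaluations bound it from above.\<close>
  have bound: "n * (n - 1) \<le> k" if k: "determined D UNIV k" for k
  proof -
    obtain W where "finite W" "card W \<le> k" "D \<subseteq> forms.span W" by (rule determined_span[OF D(2) k])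
    then show ?thesis using forms.dim_le_card dimD by (metis le_trans)
  qed
  have fam: "irreducible_optimal_family scale Basis n S D"
  proof
    show "dim UNIV = 2 * n" "n \<ge> 2" by fact+
    show "infinite (UNIV :: 'f set) \<or> card (UNIV :: 'f set) > 2 * n - 2" by fact
    show "S \<subseteq> alternating_forms scale"
      unfolding D(3) using s1 D(1) forms.subspace_add[OF sub] by blast
    show "D \<subseteq> alternating_forms scale" "forms.subspace D" by fact+
    show "S = (\<lambda>d. s + d) ` D" if "s \<in> S" for s by (rule translate[OF that])
    show "S \<noteq> {}" using irr by (simp add: irreducible_forms_def)
    show "nondegenerate s" if "s \<in> S" for s by (rule nd[OF that])
    show "n * (n - 1) \<le> k" if "determined D UNIV k" for k by (rule bound[OF that])
    show False if "subspace W" "W \<noteq> {0}" "\<And>s. s \<in> S \<Longrightarrow> W \<subseteq> orthogonal_of s W"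
      "\<And>s t. s \<in> S \<Longrightarrow> t \<in> S \<Longrightarrow> orthogonal_of s W \<subseteq> orthogonal_of t W" for W
      using irr that unfolding irreducible_forms_def by (meson subset_antisym)
  qed
  show ?thesis using fam dimD by (rule that)
qed

text \<open>The finite set \<open>W\<close> bounds all independent sets in \<open>V\<close>, so the
  comparison of dimensions is meaningful even though the ambient space of functions may be
  infinite-dimensional.\<close>

lemma (in vector_space) subspace_eq_if_dim_le:
  assumes "subspace U" "subspace V" "U \<subseteq> V" "dim V \<le> dim U" "finite W" "V \<subseteq> span W"
  shows "V \<subseteq> U"
proof
  fix v assume v: "v \<in> V"
  obtain B where B: "B \<subseteq> U" "independent B" "U \<subseteq> span B" "card B = dim U" using basis_exists by metis
  have finB: "finite B"
    using independent_span_bound[OF assms(5) B(2)] B(1) assms(3,6) by blast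
  show "v \<in> U"
  proof (rule ccontr)
    assume "v \<notin> U"
    then have "v \<notin> span B" using span_minimal[OF B(1) assms(1)] by blast
    then have indep: "independent (insert v B)" "v \<notin> B" using B(2) independent_insertI span_base by blast+
    obtain C where C: "C \<subseteq> V" "independent C" "V \<subseteq> span C" "card C = dim V" using basis_exists by metis
    have "finite C" using independent_span_bound[OF assms(5) C(2)] C(1) assms(6) by blast
    then have "card (insert v B) \<le> card C"
      using independent_span_bound[OF _ indep(1), of C] v B(1) C(3) assms(3) by blast
    then show False using finB indep(2) B(4) C(4) assms(4) by simp
  qed
qed

theorem theorem1p10:
  fixes scale :: "'f::field \<Rightarrow> 'v::ab_group_add \<Rightarrow> 'v"
    and n :: nat
    and S :: "('v \<Rightarrow> 'v \<Rightarrow> 'f) set"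
    and s0 :: "'v \<Rightarrow> 'v \<Rightarrow> 'f"
  assumes "vector_space scale"
    and "vector_space.dim scale (UNIV :: 'v set) = 2 * n"
    and "n \<ge> 2"
    and "infinite (UNIV :: 'f set) \<or> card (UNIV :: 'f set) > 2 * n - 2"
    and "optimal_symplectic_affine_subspace scale S"
    and "irreducible_forms scale S"
    and "s0 \<in> S"
  shows "\<exists>L a. quadratic_extension scale L \<and>
           a \<in> endomorphisms scale \<and>
           L = generated_algebra scale a \<and>
           nonisotropic scale (\<lambda>x y. s0 x (a y)) \<and>
           S = (\<lambda>w. s0 + w) ` W_space scale L"
proof -
  interpret vector_space scale by fact
  obtain Basis where "finite Basis" "independent Basis" "span Basis = UNIV"
  proof -
    obtain B where B: "independent B" "UNIV \<subseteq> span B" "card B = dim UNIV"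
      using basis_exists[of UNIV] by metis
    have "0 < card B" using B(3) assms(2,3) by simp
    then have "finite B" by (rule card_ge_0_finite)
    moreover have "span B = UNIV" using B(2) by (simp add: top.extremum_unique)
    ultimately show ?thesis using B(1) by (intro that)
  qed
  then have fd: "finite_dimensional_vector_space scale Basis"
    by unfold_locales
  obtain D where fam: "irreducible_optimal_family scale Basis n S D"
    and dimD: "n * (n - 1) \<le> forms.dim D"
    by (rule irreducible_optimal_familyI[OF fd assms(2-6)]) (rule that)
  interpret irreducible_optimal_family scale Basis n S D by (rule fam)
  obtain a \<alpha> \<beta> where a: "Vector_Spaces.linear scale scale a"
    and iso: "\<And>d z. d \<in> D \<Longrightarrow> d z (a z) = 0"
    and no_eigen: "\<And>z k. a z = scale k z \<Longrightarrow> z = 0"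
    and quad: "\<And>z. a (a z) = scale \<alpha> z + scale \<beta> (a z)"
    using quadratic_endomorphism by metis
  interpret a: module_hom scale scale a using a by (simp add: linear_iff_module_hom)
  obtain v :: 'v where v: "v \<noteq> 0"
  proof -
    have "dim {0 :: 'v} < dim (UNIV :: 'v set)" using dim_space n_ge_2 by simp
    then show ?thesis using that by (metis UNIV_eq_I singletonI less_irrefl)
  qed
  define L where "L = generated_algebra scale a"
  have L: "L = {(\<lambda>z. scale p z + scale q (a z)) | p q. True}" "quadratic_extension scale L"
    unfolding L_def by (rule quadratic_extension_generated[OF assms(1) a _ quad v], erule no_eigen)+
  define W where "W = W_space scale L"
  have W_iff: "s \<in> W \<longleftrightarrow> s \<in> alternating_forms scale \<and> (\<forall>x. s x (a x) = 0)" for s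
  proof
    assume s: "s \<in> W"
    have val: "s x (scale p x + scale q (a x)) = 0" for x p q
    proof -
      have "(\<lambda>z. scale p z + scale q (a z)) \<in> L" unfolding L(1) by blast
      moreover have "\<forall>l\<in>L. s x (l x) = 0" using s by (simp add: W_def W_space_def)
      ultimately show ?thesis by auto
    qed
    show "s \<in> alternating_forms scale \<and> (\<forall>x. s x (a x) = 0)"
      using s val[of _ 1 0] val[of _ 0 1] by (auto simp: W_def W_space_def alternating_forms_def)
  next
    assume s: "s \<in> alternating_forms scale \<and> (\<forall>x. s x (a x) = 0)"
    then show "s \<in> W"
      by (auto simp: W_def W_space_def L(1) alternating_simps[of s scale] alternating_forms_def)
  qed
  note sub = subspace_alternating_forms[OF assms(1)]
  have subW: "forms.subspace W"
    by (rule forms.subspaceI)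
      (auto simp: W_iff forms.subspace_0[OF sub] forms.subspace_add[OF sub] forms.subspace_scale[OF sub])
  have DW: "D \<subseteq> W" using iso D_alternating by (auto simp: W_iff)
  note s0 = S_simps[OF assms(7)]
  have s0_alt: "s0 \<in> alternating_forms scale" using S_alternating assms(7) by blast
  \<comment> \<open>The vector \<open>a x\<close> lies in \<open>plane x\<close>; if it were
    orthogonal to \<open>x\<close> it would be a multiple of \<open>x\<close>, making
    \<open>x\<close> an eigenvector.\<close>
  have aniso: "s0 x (a x) \<noteq> 0" if x: "x \<noteq> 0" for x
  proof
    assume "s0 x (a x) = 0"
    moreover have "a x \<in> plane x" using iso by (simp add: plane_def)
    ultimately have "a x \<in> span {x}" using plane_isotropic[OF assms(7) x] by blast
    then obtain k where "a x = scale k x" by (auto simp: span_singleton)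
    then show False using no_eigen x by blast
  qed
  \<comment> \<open>Every \<open>s0 + w\<close> takes the nonzero value \<open>s0 x (a x)\<close> at
    \<open>x\<close>, \<open>a x\<close> for nonzero \<open>x\<close>. So the dimension bound
    applies to \<open>W\<close> itself and forces \<open>W = D\<close>.\<close>
  have fam_W: "nondeg_family scale Basis UNIV s0 W"
  proof
    fix w x assume w: "w \<in> W" and zero: "\<And>y. y \<in> UNIV \<Longrightarrow> s0 x y + w x y = 0"
    have "s0 x (a x) = 0" using zero[of "a x"] w by (simp add: W_iff)
    then show "x = 0" using aniso by blast
  qed (use s0_alt subW W_iff in auto)
  have "determined W UNIV (n * (n - 1))"
    using assms(2,4) by (intro determined_bound[OF fam_W]) auto
  then obtain G where G: "finite G" "card G \<le> n * (n - 1)" "W \<subseteq> forms.span G"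
    by (rule determined_span[OF subW])
  then have "forms.dim W \<le> forms.dim D"
    using forms.dim_le_card[OF G(3,1)] dimD by linarith
  then have "W \<subseteq> D"
    using forms.subspace_eq_if_dim_le[OF subspace_D subW DW _ G(1,3)] by blast
  then have "S = (\<lambda>w. s0 + w) ` W" using DW S_translate[OF assms(7)] by blast
  moreover have "nonisotropic scale (\<lambda>x y. s0 x (a y))"
    unfolding nonisotropic_def bilinear_form_def
    using aniso assms(1) by (auto intro!: functionalI simp: a.add a.scale s0)
  moreover have "a \<in> endomorphisms scale" using a by (simp add: endomorphisms_def)
  ultimately show ?thesis using L(2) unfolding W_def L_def by blast
qed

end
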